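(* Let $\{\underline{\mathbf{W}}_i\}\in\mathcal{W}$, put $\mathbf{S}_k=\sum_{j=1}^{K}\omega_j\mathbf{H}_{j,k}^{\mathsf{H}}\mathbf{A}_j\mathbf{H}_{j,k}$, and let $\eta_k>0$ satisfy $\eta_k\ge\lambda_{\max}(\mathbf{S}_k)$ for $k=1,\dots,K$. Define $$\begin{aligned}\ell'(\{\mathbf{W}_i\},\{\underline{\mathbf{W}}_i\})=&-\sum_{k=1}^{K}\mathrm{tr}\Bigl(\eta_k\mathbf{W}_k^{\mathsf{H}}\mathbf{W}_k+2\mathrm{Re}\bigl(\mathbf{W}_k^{\mathsf{H}}(\mathbf{S}_k-\eta_k\mathbf{I})\underline{\mathbf{W}}_k\bigr)+\underline{\mathbf{W}}_k^{\mathsf{H}}(\eta_k\mathbf{I}-\mathbf{S}_k)\underline{\mathbf{W}}_k\Bigr)\\&+\sum_{k=1}^{K}2\omega_k\mathrm{Re}\bigl(\mathrm{tr}(\mathbf{B}_k\mathbf{H}_{k,k}\mathbf{W}_k)\bigr)+\sum_{k=1}^{K}\omega_k\bigl(\underline{\mathsf{R}}_k-\mathrm{tr}(\underline{\mathbf{W}}_k^{\mathsf{H}}\mathbf{H}_{k,k}^{\mathsf{H}}\underline{\mathbf{F}}_k^{-1}\mathbf{H}_{k,k}\underline{\mathbf{W}}_k)-\sigma_k^2\mathrm{tr}(\mathbf{A}_k)\bigr).\end{aligned}$$ Then $\ell'(\cdot,\{\underline{\mathbf{W}}_i\})$ is a surrogate function of the weighted sum-rate $f$ at $\{\underline{\mathbf{W}}_i\}$: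 $\ell'(\{\mathbf{W}_i\},\{\underline{\mathbf{W}}_i\})\le f(\{\mathbf{W}_i\})$ for all $\{\mathbf{W}_i\}\in\mathcal{W}$, with equality at $\{\mathbf{W}_i\}=\{\underline{\mathbf{W}}_i\}$. Moreover, maximizing $\ell'(\cdot,\{\underline{\mathbf{W}}_i\})$ over $\mathcal{W}$ is equivalent to minimizing $\sum_{k=1}^{K}\eta_k\|\mathbf{W}_k-\mathbf{Q}_k\|^2$ over $\mathcal{W}$, where $$\mathbf{Q}_k=\eta_k^{-1}\Bigl(\omega_k\mathbf{H}_{k,k}^{\mathsf{H}}\mathbf{B}_k^{\mathsf{H}}-(\mathbf{S}_k-\eta_k\mathbf{I})\underline{\mathbf{W}}_k\Bigr),$$ and the solution is $$\mathbf{W}_k=\mathbf{Q}_k\min\Bigl\{\sqrt{P_k/\|\mathbf{Q}_k\|^2},\,1\Bigr\},\qquad k=1,\dots,K$$ (read as $\mathbf{W}_k=\mathbf{0}$ when $\mathbf{Q}_k=\mathbf{0}$).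
   Context: Setting: $K$ links; $\mathbf{H}_{i,j}\in\mathbb{C}^{M_i^{\mathsf r}\times M_j^{\mathsf t}}$ is the channel from transmitter $j$ to receiver $i$; $\mathbf{W}_k\in\mathbb{C}^{M_k^{\mathsf t}\times M_k^{\mathsf s}}$ is the beamformer of link $k$; $\sigma_k^2>0$, weights $\omega_k>0$, power budgets $P_k>0$. $\mathbf{F}_k=\sum_{j\ne k}\mathbf{H}_{k,j}\mathbf{W}_j\mathbf{W}_j^{\mathsf{H}}\mathbf{H}_{k,j}^{\mathsf{H}}+\sigma_k^2\mathbf{I}$, $\mathsf{R}_k=\log\det(\mathbf{I}+\mathbf{W}_k^{\mathsf{H}}\mathbf{H}_{k,k}^{\mathsf{H}}\mathbf{F}_k^{-1}\mathbf{H}_{k,k}\mathbf{W}_k)$, $f(\{\mathbf{W}_i\})=\sum_{k=1}^{K}\omega_k\mathsf{R}_k$, and $\mathcal{W}=\{\{\mathbf{W}_i\}:\|\mathbf{W}_i\|^2\le P_i,\ i=1,\dots,K\}$. Underlined quantities $\underline{\mathbf{F}}_k,\underline{\mathsf{R}}_k$ are evaluated at $\{\underline{\mathbf{W}}_i\}$. $\mathbf{B}_k=\underline{\mathbf{W}}_k^{\mathsf{H}}\mathbf{H}_{k,k}^{\mathsf{H}}\underline{\mathbf{F}}_k^{-1}$ and $\mathbf{A}_k=(\underline{\mathbf{F}}_k+\mathbf{H}_{k,k}\underline{\mathbf{W}}_k\underline{\mathbf{W}}_k^{\mathsf{H}}\mathbf{H}_{k,k}^{\mathsf{H}})^{-1}\mathbf{H}_{k,k}\underline{\mathbf{W}}_k\mathbf{B}_k$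 (Hermitian positive semidefinite). $\log$ is natural, $\|\cdot\|$ is the Frobenius norm, $\lambda_{\max}$ the largest eigenvalue, and $2\mathrm{Re}(\mathbf{A})=\mathbf{A}+\mathbf{A}^{\mathsf{H}}$ for square $\mathbf{A}$. *)

theory Defs
  imports
    Complex_Main
    "Jordan_Normal_Form.Char_Poly"
    "Jordan_Normal_Form.Schur_Decomposition"
    "Jordan_Normal_Form.Gauss_Jordan_Elimination"
begin

text \<open>
  The matrix sizes depend on the link, so matrices are those of Jordan-Normal-Form, whose
  dimensions are values and not types.
\<close>

notation mat_adjoint ("(_\<^sup>H)" [1000] 1000)

definition mtrace :: "complex mat \<Rightarrow> complex" where
  "mtrace A = (\<Sum>i<dim_row A. A $$ (i, i))"

definition frob_norm :: "complex mat \<Rightarrow> real" where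
  "frob_norm A = sqrt (\<Sum>i<dim_row A. \<Sum>j<dim_col A. (cmod (A $$ (i, j)))\<^sup>2)"

text \<open>Sum of a family of matrices of size \<open>r \<times> c\<close>.\<close>
definition msum :: "nat \<Rightarrow> nat \<Rightarrow> (nat \<Rightarrow> complex mat) \<Rightarrow> nat set \<Rightarrow> complex mat" where
  "msum r c X J = mat r c (\<lambda>(a, b). \<Sum>j\<in>J. X j $$ (a, b))"

text \<open>Unspecified if \<open>A\<close> is not invertible.\<close>
definition minv :: "complex mat \<Rightarrow> complex mat" where
  "minv A = the (mat_inverse A)"

text \<open>\<open>2 Re(A)\<close> for a square matrix; this is not the entrywise real part.\<close>
definition two_Re :: "complex mat \<Rightarrow> complex mat" where
  "two_Re A = A + A\<^sup>H"

text \<open>Meant for Hermitian \<open>A\<close> of positive size, all of whose eigenvalues are real.\<close>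
definition lambda_max :: "complex mat \<Rightarrow> real" where
  "lambda_max A = Max {r. eigenvalue A (complex_of_real r)}"

text \<open>
  The links are \<open>1, \<dots>, K\<close>; a family of beamformers is a function on \<open>nat\<close> whose values outside
  \<open>{1..K}\<close> are irrelevant. \<open>Mr\<close>, \<open>Mt\<close>, \<open>Ms\<close> count receive antennas, transmit antennas and
  streams; \<open>H i j\<close> is the channel from transmitter \<open>j\<close> to receiver \<open>i\<close>.
\<close>

context
  fixes K :: nat
    and Mr Mt Ms :: "nat \<Rightarrow> nat"
    and H :: "nat \<Rightarrow> nat \<Rightarrow> complex mat"
    and \<sigma> \<omega> P :: "nat \<Rightarrow> real"
begin

definition feasible :: "(nat \<Rightarrow> complex mat) set" where
  "feasible = {W. \<forall>i\<in>{1..K}. W i \<in> carrier_mat (Mt i) (Ms i) \<and> (frob_norm (W i))\<^sup>2 \<le> P i}"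

definition F_mat :: "(nat \<Rightarrow> complex mat) \<Rightarrow> nat \<Rightarrow> complex mat" where
  "F_mat W k =
     msum (Mr k) (Mr k) (\<lambda>j. H k j * W j * (W j)\<^sup>H * (H k j)\<^sup>H) ({1..K} - {k})
     + complex_of_real ((\<sigma> k)\<^sup>2) \<cdot>\<^sub>m 1\<^sub>m (Mr k)"

text \<open>\<open>F_mat W k\<close> is Hermitian positive definite, so the determinant is real and at least 1
  and \<open>Re\<close> is only a coercion. The same holds for the traces in \<open>ell'\<close>, except
  \<open>2 \<omega>\<^sub>k Re (tr (B\<^sub>k H\<^sub>k\<^sub>k W\<^sub>k))\<close>, where the real part is genuine.\<close>
definition rate :: "(nat \<Rightarrow> complex mat) \<Rightarrow> nat \<Rightarrow> real" where
  "rate W k =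
     ln (Re (det (1\<^sub>m (Ms k) + (W k)\<^sup>H * (H k k)\<^sup>H * minv (F_mat W k) * H k k * W k)))"

definition sum_rate :: "(nat \<Rightarrow> complex mat) \<Rightarrow> real" where
  "sum_rate W = (\<Sum>k = 1..K. \<omega> k * rate W k)"

text \<open>From here on \<open>V\<close> stands for the underlined point at which the surrogate is built.\<close>

definition B_mat :: "(nat \<Rightarrow> complex mat) \<Rightarrow> nat \<Rightarrow> complex mat" where
  "B_mat V k = (V k)\<^sup>H * (H k k)\<^sup>H * minv (F_mat V k)"

definition A_mat :: "(nat \<Rightarrow> complex mat) \<Rightarrow> nat \<Rightarrow> complex mat" where
  "A_mat V k =
     minv (F_mat V k + H k k * V k * (V k)\<^sup>H * (H k k)\<^sup>H) * H k k * V k * B_mat V k"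

definition S_mat :: "(nat \<Rightarrow> complex mat) \<Rightarrow> nat \<Rightarrow> complex mat" where
  "S_mat V k =
     msum (Mt k) (Mt k)
       (\<lambda>j. complex_of_real (\<omega> j) \<cdot>\<^sub>m ((H j k)\<^sup>H * A_mat V j * H j k)) {1..K}"

definition ell' ::
  "(nat \<Rightarrow> real) \<Rightarrow> (nat \<Rightarrow> complex mat) \<Rightarrow> (nat \<Rightarrow> complex mat) \<Rightarrow> real" where
  "ell' \<eta> W V =
     - (\<Sum>k = 1..K. Re (mtrace (
           complex_of_real (\<eta> k) \<cdot>\<^sub>m ((W k)\<^sup>H * W k)
           + two_Re ((W k)\<^sup>H * (S_mat V k - complex_of_real (\<eta> k) \<cdot>\<^sub>m 1\<^sub>m (Mt k)) * V k)
           + (V k)\<^sup>H * (complex_of_real (\<eta> k) \<cdot>\<^sub>m 1\<^sub>m (Mt k) - S_mat V k) * V k)))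
     + (\<Sum>k = 1..K. 2 * \<omega> k * Re (mtrace (B_mat V k * H k k * W k)))
     + (\<Sum>k = 1..K. \<omega> k *
           (rate V k
            - Re (mtrace ((V k)\<^sup>H * (H k k)\<^sup>H * minv (F_mat V k) * H k k * V k))
            - (\<sigma> k)\<^sup>2 * Re (mtrace (A_mat V k))))"

definition Q_mat :: "(nat \<Rightarrow> real) \<Rightarrow> (nat \<Rightarrow> complex mat) \<Rightarrow> nat \<Rightarrow> complex mat" where
  "Q_mat \<eta> V k =
     complex_of_real (inverse (\<eta> k)) \<cdot>\<^sub>m
       (complex_of_real (\<omega> k) \<cdot>\<^sub>m ((H k k)\<^sup>H * (B_mat V k)\<^sup>H)
        - (S_mat V k - complex_of_real (\<eta> k) \<cdot>\<^sub>m 1\<^sub>m (Mt k)) * V k)"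

end

end

theory Submission
  imports Defs "HOL-Analysis.Convex"
begin

text \<open>
  Each rate is \<open>- ln det E\<close> with \<open>E\<close> the error covariance of the MMSE receiver. Linearising the
  concave function \<open>ln det\<close> at the base point and replacing the MMSE receiver by the one of the
  base point gives a minorant of the sum-rate that is concave quadratic in the beamformers, with
  quadratic part \<open>- \<Sum>\<^sub>k tr (W\<^sub>k\<^sup>H S\<^sub>k W\<^sub>k)\<close>. Since \<open>S\<^sub>k \<le> \<eta>\<^sub>k I\<close>, subtracting
  \<open>\<Sum>\<^sub>k tr ((W\<^sub>k - V\<^sub>k)\<^sup>H (\<eta>\<^sub>k I - S\<^sub>k) (W\<^sub>k - V\<^sub>k))\<close> yields a smaller minorant \<open>\<ell>'\<close>, still tight at
  \<open>V\<close>, whose quadratic part is the scalar one \<open>\<eta>\<^sub>k \<parallel>W\<^sub>k\<parallel>\<^sup>2\<close>. Completing the square turns its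
  maximisation into a separate projection of each \<open>Q\<^sub>k\<close> onto a ball.
\<close>

section \<open>Matrix algebra, trace and Frobenius norm\<close>

text \<open>The coefficient matrices arise from weighting error covariances. If \<open>U\<close> is
  the MMSE receiver and \<open>N\<close> the inverse error covariance at the base point, then
  \<open>N * U\<^sup>H = B\<^sub>k\<close>, hence \<open>A\<^sub>k = U * N * U\<^sup>H\<close>. The
  interference at receiver k and its own signal together run over all transmitters, so the trace of
  \<open>A\<^sub>k\<close> against the total received covariance is the noise term plus one
  quadratic form per beamformer. Collecting these forms by transmitter instead of by receiver, with
  the weights, produces \<open>S\<^sub>k\<close>. The order arguments avoid Hermitian
  diagonalisation and square roots. A product of two positive definite matrices need not be
  Hermitian, so its trace and determinant are reached through Schur triangularisation and the signs
  of its eigenvalues. The step from a bound on \<open>lambda_max\<close> to semidefiniteness is made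
  by Frobenius norm estimates alone.\<close>

lemma mat_adjoint_dims [simp]: "dim_row (A\<^sup>H) = dim_col A" "dim_col (A\<^sup>H) = dim_row A"
  by (auto simp: mat_adjoint_def)

lemma mat_adjoint_index [simp]:
  "i < dim_col A \<Longrightarrow> j < dim_row A \<Longrightarrow> A\<^sup>H $$ (i, j) = conjugate (A $$ (j, i))"
  by (simp add: mat_adjoint_def mat_of_rows_index)

lemma mat_adjoint_carrier [simp]: "A\<^sup>H \<in> carrier_mat m n \<longleftrightarrow> A \<in> carrier_mat n m"
  unfolding carrier_mat_def mem_Collect_eq mat_adjoint_dims by (rule conj_commute)

lemma mat_adjoint_adjoint [simp]: "(A\<^sup>H)\<^sup>H = (A :: complex mat)"
  by (rule eq_matI) auto

lemma mat_adjoint_one [simp]: "(1\<^sub>m n)\<^sup>H = (1\<^sub>m n :: complex mat)"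
  by (rule eq_matI) auto

lemma mat_adjoint_smult: "(c \<cdot>\<^sub>m A)\<^sup>H = cnj c \<cdot>\<^sub>m (A :: complex mat)\<^sup>H"
  by (rule eq_matI) auto

lemma mat_adjoint_mult:
  fixes A B :: "complex mat"
  shows "dim_col A = dim_row B \<Longrightarrow> (A * B)\<^sup>H = B\<^sup>H * A\<^sup>H"
proof (rule eq_matI)
  assume dim: "dim_col A = dim_row B"
  fix i j assume "i < dim_row (B\<^sup>H * A\<^sup>H)" "j < dim_col (B\<^sup>H * A\<^sup>H)"
  with dim show "(A * B)\<^sup>H $$ (i, j) = (B\<^sup>H * A\<^sup>H) $$ (i, j)"
    by (simp add: scalar_prod_def) (rule sum.cong, simp, rule mult.commute)
qed auto

lemma mat_adjoint_add:
  fixes A B :: "complex mat"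
  shows "dim_row A = dim_row B \<Longrightarrow> dim_col A = dim_col B \<Longrightarrow> (A + B)\<^sup>H = A\<^sup>H + B\<^sup>H"
  by (rule eq_matI) auto

lemma mat_adjoint_minus:
  fixes A B :: "complex mat"
  shows "dim_row A = dim_row B \<Longrightarrow> dim_col A = dim_col B \<Longrightarrow> (A - B)\<^sup>H = A\<^sup>H - B\<^sup>H"
  by (rule eq_matI) auto

lemmas mat_adjoint_simps =
  mat_adjoint_smult mat_adjoint_mult mat_adjoint_add mat_adjoint_minus

text \<open>Versions of the ring laws whose side conditions on dimensions the simplifier can discharge;
  the carrier-based library versions leave the inner dimension to be guessed.\<close>

lemma mat_mult_assoc_dim:
  fixes A B C :: "complex mat"
  shows "dim_col A = dim_row B \<Longrightarrow> dim_col B = dim_row C \<Longrightarrow> A * B * C = A * (B * C)"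
  by (rule assoc_mult_mat[of A "dim_row A" "dim_row B" B "dim_row C" C "dim_col C"]) auto

lemma mat_add_mult_dim:
  fixes A B C :: "complex mat"
  shows "dim_row A = dim_row B \<Longrightarrow> dim_col A = dim_col B \<Longrightarrow> dim_col A = dim_row C
      \<Longrightarrow> (A + B) * C = A * C + B * C"
  by (rule eq_matI) (simp_all add: scalar_prod_def distrib_right sum.distrib)

lemma mat_minus_mult_dim:
  fixes A B C :: "complex mat"
  shows "dim_row A = dim_row B \<Longrightarrow> dim_col A = dim_col B \<Longrightarrow> dim_col A = dim_row C
      \<Longrightarrow> (A - B) * C = A * C - B * C"
  by (rule eq_matI) (simp_all add: scalar_prod_def left_diff_distrib sum_subtractf)

lemma mat_mult_add_dim:
  fixes A B C :: "complex mat"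
  shows "dim_row B = dim_row C \<Longrightarrow> dim_col B = dim_col C \<Longrightarrow> dim_col A = dim_row B
      \<Longrightarrow> A * (B + C) = A * B + A * C"
  by (rule eq_matI) (simp_all add: scalar_prod_def distrib_left sum.distrib)

lemma mat_mult_minus_dim:
  fixes A B C :: "complex mat"
  shows "dim_row B = dim_row C \<Longrightarrow> dim_col B = dim_col C \<Longrightarrow> dim_col A = dim_row B
      \<Longrightarrow> A * (B - C) = A * B - A * C"
  by (rule eq_matI) (simp_all add: scalar_prod_def right_diff_distrib sum_subtractf)

lemma mat_smult_mult_dim:
  fixes A B :: "complex mat"
  shows "dim_col A = dim_row B \<Longrightarrow> (c \<cdot>\<^sub>m A) * B = c \<cdot>\<^sub>m (A * B)"
  by (rule eq_matI) (simp_all add: scalar_prod_def sum_distrib_left mult.assoc)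

lemma mat_mult_smult_dim:
  fixes A B :: "complex mat"
  shows "dim_col A = dim_row B \<Longrightarrow> A * (c \<cdot>\<^sub>m B) = c \<cdot>\<^sub>m (A * B)"
  by (rule eq_matI) (simp_all add: scalar_prod_def sum_distrib_left mult.left_commute)

lemmas mat_distrib_dim = mat_add_mult_dim mat_minus_mult_dim mat_mult_add_dim
  mat_mult_minus_dim mat_smult_mult_dim mat_mult_smult_dim

lemma mat_one_mult_dim [simp]:
  fixes A :: "complex mat"
  shows "dim_row A = n \<Longrightarrow> 1\<^sub>m n * A = A" "dim_col A = n \<Longrightarrow> A * 1\<^sub>m n = A"
  by auto

lemmas mat_ring_simps = mat_mult_assoc_dim mat_distrib_dim mat_adjoint_simps

section \<open>Trace identities and the Frobenius norm\<close>

lemma mtrace_add: "dim_row A = dim_row B \<Longrightarrow> dim_col A = dim_row A \<Longrightarrow> dim_col B = dim_row B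
    \<Longrightarrow> mtrace (A + B) = mtrace A + mtrace B"
  by (simp add: mtrace_def sum.distrib)

lemma mtrace_minus: "dim_row A = dim_row B \<Longrightarrow> dim_col A = dim_row A \<Longrightarrow> dim_col B = dim_row B
    \<Longrightarrow> mtrace (A - B) = mtrace A - mtrace B"
  by (simp add: mtrace_def sum_subtractf)

lemma mtrace_smult: "dim_col A = dim_row A \<Longrightarrow> mtrace (c \<cdot>\<^sub>m A) = c * mtrace A"
  by (simp add: mtrace_def sum_distrib_left)

lemma mtrace_one [simp]: "mtrace (1\<^sub>m n) = of_nat n"
  by (simp add: mtrace_def)

lemma mtrace_adjoint: "dim_col A = dim_row A \<Longrightarrow> mtrace (A\<^sup>H) = cnj (mtrace A)"
  by (simp add: mtrace_def)

lemmas mtrace_simps = mtrace_add mtrace_minus mtrace_smult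

lemma mtrace_mult_entries:
  assumes "dim_col A = dim_row B" "dim_col B = dim_row A"
  shows "mtrace (A * B) = (\<Sum>i<dim_row A. \<Sum>j<dim_row B. A $$ (i, j) * B $$ (j, i))"
  using assms by (auto simp: mtrace_def scalar_prod_def lessThan_atLeast0 intro!: sum.cong)

lemma mtrace_comm:
  assumes "dim_col A = dim_row B" "dim_col B = dim_row A"
  shows "mtrace (A * B) = mtrace (B * A)"
  using assms by (subst (1 2) mtrace_mult_entries) (simp_all add: sum.swap[of _ "{..<dim_row A}"] mult.commute)

lemma mtrace_adjoint_mult:
  "dim_row A = dim_row B \<Longrightarrow> dim_col A = dim_col B
    \<Longrightarrow> mtrace (A\<^sup>H * B) = (\<Sum>i<dim_row A. \<Sum>j<dim_col A. cnj (A $$ (i, j)) * B $$ (i, j))"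
  by (subst sum.swap) (auto simp: mtrace_def scalar_prod_def lessThan_atLeast0 intro!: sum.cong)

lemma frob_norm_nonneg [simp]: "frob_norm A \<ge> 0"
  by (simp add: frob_norm_def sum_nonneg)

lemma frob_norm_sq_entries:
  "(frob_norm A)\<^sup>2 = (\<Sum>i<dim_row A. \<Sum>j<dim_col A. (cmod (A $$ (i, j)))\<^sup>2)"
  by (simp add: frob_norm_def sum_nonneg)

lemma mtrace_gram: "mtrace (A\<^sup>H * A) = complex_of_real ((frob_norm A)\<^sup>2)"
proof -
  have *: "cnj z * z = complex_of_real ((cmod z)\<^sup>2)" for z
    by (metis complex_norm_square mult.commute of_real_power)
  show ?thesis
    by (simp only: mtrace_adjoint_mult frob_norm_sq_entries * of_real_sum)
qed

lemma frob_norm_sq: "(frob_norm A)\<^sup>2 = Re (mtrace (A\<^sup>H * A))"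
  by (simp only: mtrace_gram Re_complex_of_real)

lemma frob_norm_eq_0: "frob_norm A = 0 \<longleftrightarrow> A = 0\<^sub>m (dim_row A) (dim_col A)"
proof
  assume "frob_norm A = 0"
  hence "(\<Sum>i<dim_row A. \<Sum>j<dim_col A. (cmod (A $$ (i, j)))\<^sup>2) = 0"
    using frob_norm_sq_entries[of A] by simp
  hence "\<forall>i<dim_row A. (\<Sum>j<dim_col A. (cmod (A $$ (i, j)))\<^sup>2) = 0"
    by (subst (asm) sum_nonneg_eq_0_iff) (auto simp: sum_nonneg)
  hence "\<forall>i<dim_row A. \<forall>j<dim_col A. A $$ (i, j) = 0"
    by (simp add: sum_nonneg_eq_0_iff)
  thus "A = 0\<^sub>m (dim_row A) (dim_col A)" by (intro eq_matI) auto
next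
  assume *: "A = 0\<^sub>m (dim_row A) (dim_col A)"
  have "frob_norm (0\<^sub>m m n) = 0" for m n by (simp add: frob_norm_def)
  with arg_cong[OF *, of frob_norm] show "frob_norm A = 0" by (simp only:)
qed

text \<open>Cauchy-Schwarz bounds each entry of the product by a row norm of \<open>A\<close> times
  a column norm of \<open>B\<close>, and the double sum of these bounds factors. This
  submultiplicativity stands in for operator norms in the eigenvalue estimates below.\<close>

lemma frob_norm_mult_le:
  assumes "dim_col A = dim_row B"
  shows "frob_norm (A * B) \<le> frob_norm A * frob_norm B"
proof -
  have entry: "(cmod ((A * B) $$ (i, j)))\<^sup>2
      \<le> (\<Sum>k<dim_row B. (cmod (A $$ (i, k)))\<^sup>2) * (\<Sum>k<dim_row B. (cmod (B $$ (k, j)))\<^sup>2)"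
    if "i < dim_row A" "j < dim_col B" for i j
  proof -
    have "cmod ((A * B) $$ (i, j)) \<le> (\<Sum>k<dim_row B. cmod (A $$ (i, k)) * cmod (B $$ (k, j)))"
      using that assms
      by (auto simp: scalar_prod_def lessThan_atLeast0 norm_mult intro!: sum_norm_le)
    hence "(cmod ((A * B) $$ (i, j)))\<^sup>2
        \<le> (\<Sum>k<dim_row B. cmod (A $$ (i, k)) * cmod (B $$ (k, j)))\<^sup>2"
      by (simp add: power_mono)
    also have "\<dots> \<le> (\<Sum>k<dim_row B. (cmod (A $$ (i, k)))\<^sup>2) * (\<Sum>k<dim_row B. (cmod (B $$ (k, j)))\<^sup>2)"
      by (rule Cauchy_Schwarz_ineq_sum)
    finally show ?thesis .
  qed
  have "(frob_norm (A * B))\<^sup>2 \<le> (\<Sum>i<dim_row A. \<Sum>j<dim_col B.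
      (\<Sum>k<dim_row B. (cmod (A $$ (i, k)))\<^sup>2) * (\<Sum>k<dim_row B. (cmod (B $$ (k, j)))\<^sup>2))"
    unfolding frob_norm_sq_entries index_mult_mat(2,3) by (intro sum_mono entry) auto
  also have "\<dots> = (frob_norm A)\<^sup>2 * (\<Sum>j<dim_col B. \<Sum>k<dim_row B. (cmod (B $$ (k, j)))\<^sup>2)"
    by (simp only: frob_norm_sq_entries assms sum_distrib_right[symmetric] sum_distrib_left[symmetric])
  also have "(\<Sum>j<dim_col B. \<Sum>k<dim_row B. (cmod (B $$ (k, j)))\<^sup>2) = (frob_norm B)\<^sup>2"
    unfolding frob_norm_sq_entries by (rule sum.swap)
  finally show ?thesis
    by (intro power2_le_imp_le[OF _ mult_nonneg_nonneg]) (simp_all add: power_mult_distrib)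
qed

section \<open>Positive definite matrices\<close>

lemmas mat_expand = mat_ring_simps mtrace_simps

text \<open>The form is tested on matrices of any width, since a trace form is the sum of the vector
  forms over the columns. Beamformers can thus be inserted directly. For a Hermitian
  \<open>A\<close> the trace is real and \<open>Re\<close> is only a coercion.\<close>

definition pos_semidef :: "nat \<Rightarrow> complex mat \<Rightarrow> bool" where
  "pos_semidef n A \<longleftrightarrow> A \<in> carrier_mat n n \<and> A\<^sup>H = A \<and>
     (\<forall>m. \<forall>Z\<in>carrier_mat n m. 0 \<le> Re (mtrace (Z\<^sup>H * (A * Z))))"

definition pos_def :: "nat \<Rightarrow> complex mat \<Rightarrow> bool" where
  "pos_def n A \<longleftrightarrow> A \<in> carrier_mat n n \<and> A\<^sup>H = A \<and>
     (\<forall>m. \<forall>Z\<in>carrier_mat n m. Z \<noteq> 0\<^sub>m n m \<longrightarrow> 0 < Re (mtrace (Z\<^sup>H * (A * Z))))"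

lemma pos_semidefD:
  assumes "pos_semidef n A"
  shows "A \<in> carrier_mat n n" "A\<^sup>H = A" "dim_row A = n" "dim_col A = n"
    and "dim_row Z = n \<Longrightarrow> 0 \<le> Re (mtrace (Z\<^sup>H * (A * Z)))"
  using assms unfolding pos_semidef_def by (blast, blast, blast, blast, metis carrier_matI)

lemma pos_defD:
  assumes "pos_def n A"
  shows "A \<in> carrier_mat n n" "A\<^sup>H = A" "dim_row A = n" "dim_col A = n"
    and "Z \<in> carrier_mat n m \<Longrightarrow> Z \<noteq> 0\<^sub>m n m \<Longrightarrow> 0 < Re (mtrace (Z\<^sup>H * (A * Z)))"
  using assms unfolding pos_def_def by (blast, blast, blast, blast, blast)

lemma mtrace_zero [simp]: "mtrace (0\<^sub>m n n) = 0"
  by (simp add: mtrace_def)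

lemma pos_def_imp_pos_semidef: "pos_def n A \<Longrightarrow> pos_semidef n A"
  unfolding pos_semidef_def
proof (intro conjI allI ballI)
  assume A: "pos_def n A"
  from pos_defD[OF A] show "A \<in> carrier_mat n n" "A\<^sup>H = A" by blast+
  fix m and Z :: "complex mat" assume Z: "Z \<in> carrier_mat n m"
  have Z0: "(0\<^sub>m n m)\<^sup>H * (A * 0\<^sub>m n m) = 0\<^sub>m m m"
    using pos_defD(1)[OF A] by (intro eq_matI) auto
  show "0 \<le> Re (mtrace (Z\<^sup>H * (A * Z)))"
    using pos_defD(5)[OF A Z] Z0 by (cases "Z = 0\<^sub>m n m") auto
qed

lemma hermitian_form_real:
  assumes "A\<^sup>H = A" "dim_row A = n" "dim_col A = n" "dim_row Z = n"
  shows "mtrace (Z\<^sup>H * (A * Z)) = complex_of_real (Re (mtrace (Z\<^sup>H * (A * Z))))"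
proof -
  have "(Z\<^sup>H * (A * Z))\<^sup>H = Z\<^sup>H * (A * Z)"
    using assms by (simp add: mat_ring_simps)
  hence "cnj (mtrace (Z\<^sup>H * (A * Z))) = mtrace (Z\<^sup>H * (A * Z))"
    using mtrace_adjoint[of "Z\<^sup>H * (A * Z)"] assms by simp
  thus ?thesis by (simp add: complex_eq_iff)
qed

lemma pos_def_one: "pos_def n (1\<^sub>m n)"
  unfolding pos_def_def
proof (intro conjI allI ballI impI)
  fix m and Z :: "complex mat" assume Z: "Z \<in> carrier_mat n m" "Z \<noteq> 0\<^sub>m n m"
  hence "frob_norm Z \<noteq> 0" by (auto simp: frob_norm_eq_0)
  hence "(frob_norm Z)\<^sup>2 > 0" by simp
  thus "0 < Re (mtrace (Z\<^sup>H * (1\<^sub>m n * Z)))" using Z by (simp add: frob_norm_sq)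
qed auto

section \<open>Eigenvectors as one-column matrices, singularity and inverses\<close>

lemma mult_mat_vec_column:
  fixes A :: "complex mat"
  assumes A: "A \<in> carrier_mat n n" and v: "v \<in> carrier_vec n" "v \<noteq> 0\<^sub>v n"
    and ev: "A *\<^sub>v v = e \<cdot>\<^sub>v v"
  obtains Z where "Z \<in> carrier_mat n 1" "Z \<noteq> 0\<^sub>m n 1" "A * Z = e \<cdot>\<^sub>m Z"
proof
  let ?Z = "mat n 1 (\<lambda>(i, j). v $ i)"
  show Z: "?Z \<in> carrier_mat n 1" by simp
  have col: "col ?Z 0 = v" using v by (intro eq_vecI) auto
  show "?Z \<noteq> 0\<^sub>m n 1"
  proof
    assume "?Z = 0\<^sub>m n 1"
    hence "col ?Z 0 = col (0\<^sub>m n 1) 0" by (simp only:)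
    with col v show False by auto
  qed
  show "A * ?Z = e \<cdot>\<^sub>m ?Z"
  proof (rule eq_matI)
    fix i j assume "i < dim_row (e \<cdot>\<^sub>m ?Z)" "j < dim_col (e \<cdot>\<^sub>m ?Z)"
    hence ij: "i < n" "j = 0" by auto
    have "(A * ?Z) $$ (i, j) = row A i \<bullet> col ?Z 0" using ij A by simp
    also have "\<dots> = (A *\<^sub>v v) $ i" using ij A by (simp only: col) simp
    also have "\<dots> = (e \<cdot>\<^sub>m ?Z) $$ (i, j)" using ij v by (simp only: ev) simp
    finally show "(A * ?Z) $$ (i, j) = (e \<cdot>\<^sub>m ?Z) $$ (i, j)" .
  qed (use A in auto)
qed

lemma eigenvalue_column:
  fixes A :: "complex mat"
  assumes A: "A \<in> carrier_mat n n" and ev: "eigenvalue A e"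
  obtains Z where "Z \<in> carrier_mat n 1" "Z \<noteq> 0\<^sub>m n 1" "A * Z = e \<cdot>\<^sub>m Z"
proof -
  from ev A obtain v where "v \<in> carrier_vec n" "v \<noteq> 0\<^sub>v n" "A *\<^sub>v v = e \<cdot>\<^sub>v v"
    unfolding eigenvalue_def eigenvector_def by auto
  from mult_mat_vec_column[OF A this] that show thesis by blast
qed

lemma det_eq_0_eigenvalue:
  fixes A :: "complex mat"
  assumes A: "A \<in> carrier_mat n n" and "det A = 0"
  shows "eigenvalue A 0"
proof -
  from assms obtain v where v: "v \<in> carrier_vec n" "v \<noteq> 0\<^sub>v n" "A *\<^sub>v v = 0\<^sub>v n"
    using det_0_iff_vec_prod_zero_field[OF A] by blast
  moreover have "0 \<cdot>\<^sub>v v = 0\<^sub>v n" using v by auto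
  ultimately show ?thesis using A unfolding eigenvalue_def eigenvector_def by auto
qed

text \<open>A nonzero kernel vector would make the quadratic form vanish. This gives
  \<open>minv\<close> its meaning for every covariance matrix in the proof.\<close>

lemma pos_def_det_nonzero:
  assumes A: "pos_def n A"
  shows "det A \<noteq> 0"
proof
  assume "det A = 0"
  then obtain Z where Z: "Z \<in> carrier_mat n 1" "Z \<noteq> 0\<^sub>m n 1" "A * Z = 0 \<cdot>\<^sub>m Z"
    using det_eq_0_eigenvalue[OF pos_defD(1)[OF A]] eigenvalue_column[OF pos_defD(1)[OF A]] by metis
  have "mtrace (Z\<^sup>H * (A * Z)) = 0"
    using Z by (simp only: Z(3)) (simp add: mat_mult_smult_dim mtrace_smult)
  with pos_defD(5)[OF A Z(1,2)] show False by simp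
qed

lemma minv_inverse:
  assumes A: "A \<in> carrier_mat n n" and det: "det A \<noteq> 0"
  shows "A * minv A = 1\<^sub>m n" "minv A * A = 1\<^sub>m n" "minv A \<in> carrier_mat n n"
    "dim_row (minv A) = n" "dim_col (minv A) = n"
proof -
  from det_non_zero_imp_unit[OF A det, of "()"] mat_inverse(1)[OF A, of "()"]
  obtain X where X: "mat_inverse A = Some X" by (cases "mat_inverse A") auto
  from mat_inverse(2)[OF A X] show "A * minv A = 1\<^sub>m n" "minv A * A = 1\<^sub>m n"
    "minv A \<in> carrier_mat n n" "dim_row (minv A) = n" "dim_col (minv A) = n"
    by (auto simp: minv_def X)
qed

lemma minv_unique:
  assumes A: "A \<in> carrier_mat n n" and X: "X \<in> carrier_mat n n" "A * X = 1\<^sub>m n"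
  shows "minv A = X"
proof -
  have "det A * det X = 1" using det_mult[OF A X(1)] X(2) by simp
  hence "det A \<noteq> 0" by auto
  note inv = minv_inverse[OF A this]
  have "minv A = minv A * (A * X)" using inv X by simp
  also have "\<dots> = (minv A * A) * X" using inv(3) A X by (simp add: mat_mult_assoc_dim)
  also have "\<dots> = X" unfolding inv(2) using X by simp
  finally show ?thesis .
qed

lemma minv_hermitian:
  assumes A: "A \<in> carrier_mat n n" "det A \<noteq> 0" "A\<^sup>H = A"
  shows "(minv A)\<^sup>H = minv A"
proof -
  note inv = minv_inverse[OF A(1,2)]
  have "A * (minv A)\<^sup>H = (minv A * A)\<^sup>H"
    using mat_adjoint_mult[of "minv A" A] inv(4,5) A(1) unfolding A(3) by simp
  also have "\<dots> = 1\<^sub>m n" by (simp add: inv)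
  finally show ?thesis using minv_unique[OF A(1), of "(minv A)\<^sup>H"] inv by simp
qed

text \<open>The form of the inverse at \<open>Z\<close> is the form of \<open>A\<close> at
  \<open>minv A * Z\<close>, and that argument is nonzero because \<open>A\<close> maps it back to
  \<open>Z\<close>.\<close>

lemma pos_def_minv:
  assumes A: "pos_def n A"
  shows "pos_def n (minv A)"
  unfolding pos_def_def
proof (intro conjI allI ballI impI)
  note inv = minv_inverse[OF pos_defD(1)[OF A] pos_def_det_nonzero[OF A]]
  note herm = minv_hermitian[OF pos_defD(1)[OF A] pos_def_det_nonzero[OF A] pos_defD(2)[OF A]]
  note dims = pos_defD(3,4)[OF A] inv(4,5)
  show "minv A \<in> carrier_mat n n" "(minv A)\<^sup>H = minv A" using inv herm by auto
  fix m and Z :: "complex mat" assume Z: "Z \<in> carrier_mat n m" "Z \<noteq> 0\<^sub>m n m"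
  let ?Y = "minv A * Z"
  have AY: "A * ?Y = Z"
    using Z dims inv(1) by (simp flip: mat_mult_assoc_dim)
  have "?Y \<noteq> 0\<^sub>m n m"
  proof
    assume "?Y = 0\<^sub>m n m"
    hence "A * ?Y = 0\<^sub>m n m" using dims pos_defD(1)[OF A] by simp
    with AY Z show False by simp
  qed
  hence "0 < Re (mtrace (?Y\<^sup>H * (A * ?Y)))"
    using Z inv(3) by (intro pos_defD(5)[OF A]) auto
  also have "?Y\<^sup>H * (A * ?Y) = Z\<^sup>H * (minv A * Z)"
    unfolding AY using Z dims herm by (simp add: mat_ring_simps)
  finally show "0 < Re (mtrace (Z\<^sup>H * (minv A * Z)))" .
qed

lemma pos_semidef_congruence:
  assumes A: "pos_semidef n A" and G: "G \<in> carrier_mat n m"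
  shows "pos_semidef m (G\<^sup>H * (A * G))"
  unfolding pos_semidef_def
proof (intro conjI allI ballI)
  note d = pos_semidefD(2,3,4)[OF A]
  show "G\<^sup>H * (A * G) \<in> carrier_mat m m" "(G\<^sup>H * (A * G))\<^sup>H = G\<^sup>H * (A * G)"
    using G d by (auto simp: mat_ring_simps)
  fix l and Z :: "complex mat" assume Z: "Z \<in> carrier_mat m l"
  have "0 \<le> Re (mtrace ((G * Z)\<^sup>H * (A * (G * Z))))"
    using G Z by (intro pos_semidefD(5)[OF A]) auto
  thus "0 \<le> Re (mtrace (Z\<^sup>H * ((G\<^sup>H * (A * G)) * Z)))"
    using G Z d by (simp add: mat_ring_simps)
qed

lemma pos_def_add_pos_semidef:
  assumes A: "pos_def n A" and B: "pos_semidef n B"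
  shows "pos_def n (A + B)"
  unfolding pos_def_def
proof (intro conjI allI ballI impI)
  note d = pos_defD(2,3,4)[OF A] pos_semidefD(2,3,4)[OF B]
  show "A + B \<in> carrier_mat n n" "(A + B)\<^sup>H = A + B"
    using d by (auto simp: mat_ring_simps)
  fix m and Z :: "complex mat" assume Z: "Z \<in> carrier_mat n m" "Z \<noteq> 0\<^sub>m n m"
  from pos_defD(5)[OF A Z] pos_semidefD(5)[OF B, of Z] Z d
  show "0 < Re (mtrace (Z\<^sup>H * ((A + B) * Z)))"
    by (simp add: mat_expand)
qed

text \<open>Schur triangularisation applies to every complex square matrix, so this covers products
  of Hermitian matrices that are not Hermitian themselves. A list records the eigenvalues with
  multiplicity, as trace and determinant require.\<close>

lemma schur_trace_det:
  fixes A :: "complex mat"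
  assumes A: "A \<in> carrier_mat n n"
  shows "\<exists>es. length es = n \<and> (\<forall>e\<in>set es. eigenvalue A e) \<and>
    mtrace A = sum_list es \<and> det A = prod_list es"
proof -
  from char_poly_factorized[OF A] obtain es
    where es: "char_poly A = (\<Prod>e\<leftarrow>es. [:- e, 1:])" "length es = n" by auto
  obtain B P Q where "schur_decomposition A es = (B, P, Q)"
    by (cases "schur_decomposition A es") auto
  from schur_decomposition[OF A es(1) this]
  have sim: "similar_mat_wit A B P Q" and ut: "upper_triangular B" and diag: "diag_mat B = es"
    by auto
  from similar_mat_witD2[OF A sim] have PQ: "P * Q = 1\<^sub>m n" "Q * P = 1\<^sub>m n" "A = P * B * Q"
    and carr: "B \<in> carrier_mat n n" "P \<in> carrier_mat n n" "Q \<in> carrier_mat n n" by auto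
  have "mtrace A = mtrace (P * (B * Q))"
    unfolding PQ(3) using carr by (simp add: mat_mult_assoc_dim)
  also have "\<dots> = mtrace (B * (Q * P))"
    using carr by (subst mtrace_comm) (auto simp: mat_mult_assoc_dim)
  also have "\<dots> = sum_list es"
    unfolding PQ diag[symmetric] using carr
    by (simp add: diag_mat_def mtrace_def lessThan_atLeast0 interv_sum_list_conv_sum_set_nat)
  finally have tr: "mtrace A = sum_list es" .
  have "det A = det B"
    using sim by (intro det_similar) (auto simp: similar_mat_def)
  also have "\<dots> = prod_list es"
    using det_upper_triangular[OF ut carr(1)] diag by simp
  finally have det: "det A = prod_list es" .
  have "eigenvalue A e" if "e \<in> set es" for e
    unfolding eigenvalue_root_char_poly[OF A] es(1) poly_prod_list
    using that by (auto simp: prod_list_zero_iff)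
  with es(2) tr det show ?thesis by blast
qed

text \<open>If \<open>A B z = e z\<close> then \<open>(B z)\<^sup>H A (B z) = e (z\<^sup>H B z)\<close>, and both forms are real.\<close>
lemma eigenvalue_mult_pos:
  assumes A: "pos_def n A" and B: "pos_semidef n B" and ev: "eigenvalue (A * B) e"
  shows "Im e = 0" "0 \<le> Re e" "pos_def n B \<Longrightarrow> 0 < Re e"
proof -
  note d = pos_defD(2,3,4)[OF A] pos_semidefD(2,3,4)[OF B]
  have "A * B \<in> carrier_mat n n" using d by auto
  then obtain Z where Z: "Z \<in> carrier_mat n 1" "Z \<noteq> 0\<^sub>m n 1" "A * B * Z = e \<cdot>\<^sub>m Z"
    using eigenvalue_column[OF _ ev] by metis
  define q where "q = Re (mtrace (Z\<^sup>H * (B * Z)))"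
  define p where "p = Re (mtrace ((B * Z)\<^sup>H * (A * (B * Z))))"
  have q: "mtrace (Z\<^sup>H * (B * Z)) = complex_of_real q" "0 \<le> q"
    unfolding q_def using d Z pos_semidefD(5)[OF B, of Z]
    by (auto intro!: hermitian_form_real[where n = n])
  have "complex_of_real p = mtrace ((B * Z)\<^sup>H * (A * (B * Z)))"
    unfolding p_def using d Z by (intro hermitian_form_real[where n = n, symmetric]) auto
  also have "\<dots> = mtrace ((B * Z)\<^sup>H * (A * B * Z))"
    using d Z by (simp add: mat_mult_assoc_dim)
  also have "\<dots> = e * mtrace (Z\<^sup>H * (B * Z))"
    unfolding Z(3) using d Z by (simp add: mat_expand)
  finally have pq: "complex_of_real p = e * complex_of_real q" by (simp add: q)
  have main: "Im e = 0 \<and> 0 < Re e" if "B * Z \<noteq> 0\<^sub>m n 1"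
  proof -
    have "0 < p" unfolding p_def using that Z d by (intro pos_defD(5)[OF A]) auto
    \<comment> \<open>\<open>q = 0\<close> would force \<open>p = 0\<close>; hence \<open>e\<close>
      is a quotient of two positive reals.\<close>
    with pq q(2) have "q > 0" by (cases "q = 0") auto
    with pq have "e = complex_of_real (p / q)" by (simp add: field_simps)
    with \<open>0 < p\<close> \<open>0 < q\<close> show ?thesis by simp
  qed
  \<comment> \<open>\<open>B\<close> may be singular. If \<open>B * Z\<close> vanishes, so does
    \<open>e \<cdot>\<^sub>m Z\<close>, and the eigenvalue is 0.\<close>
  have zero: "e = 0" if "B * Z = 0\<^sub>m n 1"
  proof -
    have "e \<cdot>\<^sub>m Z = A * (B * Z)" using Z d by (simp add: mat_mult_assoc_dim flip: Z(3))
    also have "\<dots> = 0\<^sub>m n 1" unfolding that using d by (intro eq_matI) auto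
    finally have eZ: "e \<cdot>\<^sub>m Z = 0\<^sub>m n 1" .
    show "e = 0"
    proof (rule ccontr)
      assume "e \<noteq> 0"
      have "Z = inverse e \<cdot>\<^sub>m (e \<cdot>\<^sub>m Z)" using \<open>e \<noteq> 0\<close> by (intro eq_matI) auto
      also have "\<dots> = 0\<^sub>m n 1" unfolding eZ by (intro eq_matI) auto
      finally show False using Z by simp
    qed
  qed
  show "Im e = 0" "0 \<le> Re e" using main zero by fastforce+
  show "0 < Re e" if B': "pos_def n B"
  proof -
    have "B * Z \<noteq> 0\<^sub>m n 1"
    proof
      assume "B * Z = 0\<^sub>m n 1"
      hence "Z\<^sup>H * (B * Z) = 0\<^sub>m 1 1" using Z by (simp only:) (intro eq_matI, auto)
      with pos_defD(5)[OF B' Z(1,2)] show False by simp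
    qed
    with main show ?thesis by blast
  qed
qed

text \<open>The trace is the sum of the eigenvalues of the product, none of which has negative real
  part. This allows a matrix inequality to be weighted by a positive definite matrix.\<close>

lemma mtrace_mult_nonneg:
  assumes A: "pos_def n A" and B: "pos_semidef n B"
  shows "0 \<le> Re (mtrace (A * B))"
proof -
  have "A * B \<in> carrier_mat n n" using pos_defD(1)[OF A] pos_semidefD(1)[OF B] by auto
  then obtain es where es: "\<And>e. e \<in> set es \<Longrightarrow> eigenvalue (A * B) e" "mtrace (A * B) = sum_list es"
    using schur_trace_det by blast
  have "\<forall>e\<in>set es. 0 \<le> Re e" using es(1) eigenvalue_mult_pos(2)[OF A B] by blast
  hence "0 \<le> Re (sum_list es)" by (induction es) auto
  thus ?thesis by (simp add: es)
qed

lemma ln_prod_list_le: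
  assumes "\<forall>e\<in>set es. Im e = 0 \<and> 0 < Re e"
  shows "Im (prod_list es) = 0 \<and> 0 < Re (prod_list es) \<and>
    ln (Re (prod_list es)) \<le> Re (sum_list es) - length es"
  using assms
proof (induction es)
  case (Cons e es)
  hence IH: "Im (prod_list es) = 0" "0 < Re (prod_list es)"
    "ln (Re (prod_list es)) \<le> Re (sum_list es) - length es" and e: "Im e = 0" "0 < Re e" by auto
  have "ln (Re e) \<le> Re e - 1" using e by (intro ln_le_minus_one)
  with IH e show ?case by (simp add: ln_mult)
qed simp

text \<open>The scalar bound \<open>ln x \<le> x - 1\<close>, summed over the eigenvalues of the
  product. With \<open>B\<close> an inverse it is the tangent inequality of the concave function
  \<open>ln det\<close>.\<close>

lemma ln_det_mult_le:
  assumes A: "pos_def n A" and B: "pos_def n B"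
  shows "Im (det (A * B)) = 0" "0 < Re (det (A * B))"
    "ln (Re (det (A * B))) \<le> Re (mtrace (A * B)) - n"
proof -
  have "A * B \<in> carrier_mat n n" using pos_defD(1)[OF A] pos_defD(1)[OF B] by auto
  then obtain es where es: "length es = n" "\<And>e. e \<in> set es \<Longrightarrow> eigenvalue (A * B) e"
    "mtrace (A * B) = sum_list es" "det (A * B) = prod_list es"
    using schur_trace_det by blast
  have "\<forall>e\<in>set es. Im e = 0 \<and> 0 < Re e"
    using es(2) eigenvalue_mult_pos[OF A pos_def_imp_pos_semidef[OF B]] B by blast
  from ln_prod_list_le[OF this] show "Im (det (A * B)) = 0" "0 < Re (det (A * B))"
    "ln (Re (det (A * B))) \<le> Re (mtrace (A * B)) - n" by (simp_all add: es)
qed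

lemma pos_def_det_pos:
  assumes "pos_def n A"
  shows "Im (det A) = 0" "0 < Re (det A)"
  using ln_det_mult_le[OF assms pos_def_one] pos_defD(3,4)[OF assms] by simp_all

lemma pos_semidef_gram:
  assumes "G \<in> carrier_mat n m"
  shows "pos_semidef n (G * G\<^sup>H)"
  using pos_semidef_congruence[OF pos_def_imp_pos_semidef[OF pos_def_one], of "G\<^sup>H" m n] assms
  by simp

section \<open>The rate bound\<close>

text \<open>One link seen from its receiver: \<open>F\<close> is the covariance of interference plus
  noise, \<open>G\<close> the channel times the beamformer. The rate bound compares two such models
  of equal size, the current point and the base point, so the locale is interpreted twice.\<close>

locale signal_model =
  fixes M s :: nat and F G :: "complex mat"
  assumes F: "pos_def M F" and G: "G \<in> carrier_mat M s"
begin

text \<open>\<open>T\<close> is the covariance of the whole received signal; \<open>N\<close> is the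
  matrix whose log-determinant is the rate, and its inverse is the MMSE error covariance.\<close>

definition T where "T = F + G * G\<^sup>H"
definition N where "N = 1\<^sub>m s + G\<^sup>H * (minv F * G)"

lemma T_pos_def: "pos_def M T"
  unfolding T_def by (intro pos_def_add_pos_semidef F pos_semidef_gram[OF G])

lemma N_pos_def: "pos_def s N"
  unfolding N_def
  by (intro pos_def_add_pos_semidef pos_def_one
      pos_semidef_congruence[OF pos_def_imp_pos_semidef[OF pos_def_minv[OF F]] G])

lemmas minv_F = minv_inverse[OF pos_defD(1)[OF F] pos_def_det_nonzero[OF F]]
lemmas minv_T = minv_inverse[OF pos_defD(1)[OF T_pos_def] pos_def_det_nonzero[OF T_pos_def]]
lemmas minv_N = minv_inverse[OF pos_defD(1)[OF N_pos_def] pos_def_det_nonzero[OF N_pos_def]]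
lemmas hermitian = pos_defD(2)[OF F] pos_defD(2)[OF T_pos_def] pos_defD(2)[OF N_pos_def]
  pos_defD(2)[OF pos_def_minv[OF F]] pos_defD(2)[OF pos_def_minv[OF T_pos_def]]
lemmas dims = carrier_matD[OF G] pos_defD(3,4)[OF F] pos_defD(3,4)[OF T_pos_def]
  pos_defD(3,4)[OF N_pos_def] minv_F(4,5) minv_T(4,5) minv_N(4,5)

text \<open>Both sides expand to
  \<open>G\<^sup>H + G\<^sup>H * minv F * G * G\<^sup>H\<close>.\<close>

lemma push_through: "N * G\<^sup>H = G\<^sup>H * (minv F * T)"
  unfolding N_def T_def
  by (simp add: mat_add_mult_dim mat_mult_add_dim mat_mult_assoc_dim dims minv_F)

lemma N_minv_T: "N * (G\<^sup>H * minv T) = G\<^sup>H * minv F"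
proof -
  have "N * (G\<^sup>H * minv T) = N * G\<^sup>H * minv T"
    by (simp add: mat_mult_assoc_dim dims)
  also have "\<dots> = G\<^sup>H * (minv F * (T * minv T))"
    unfolding push_through by (simp add: mat_mult_assoc_dim dims)
  finally show ?thesis by (simp add: minv_T dims)
qed

text \<open>A case of the Woodbury identity: multiplied by \<open>N\<close>, the candidate becomes
  \<open>N - G\<^sup>H * minv F * G\<close> by \<open>N_minv_T\<close>, which is the
  identity.\<close>

lemma minv_N_eq: "minv N = 1\<^sub>m s - G\<^sup>H * (minv T * G)"
proof (rule minv_unique[OF pos_defD(1)[OF N_pos_def]])
  show "1\<^sub>m s - G\<^sup>H * (minv T * G) \<in> carrier_mat s s"
    using G by (auto simp: dims)
  have "N * (1\<^sub>m s - G\<^sup>H * (minv T * G)) = N - N * (G\<^sup>H * minv T) * G"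
    by (simp add: mat_mult_minus_dim mat_mult_assoc_dim dims)
  also have "\<dots> = N - G\<^sup>H * (minv F * G)"
    unfolding N_minv_T by (simp add: mat_mult_assoc_dim dims)
  also have "\<dots> = 1\<^sub>m s"
    unfolding N_def by (intro eq_matI) (auto simp: dims)
  finally show "N * (1\<^sub>m s - G\<^sup>H * (minv T * G)) = 1\<^sub>m s" .
qed

end

text \<open>The WMMSE lower bound. With \<open>E = N\<^sup>-\<^sup>1\<close> the error covariance of the MMSE receiver
  \<open>T\<^sup>-\<^sup>1 G\<close>, concavity of \<open>ln det\<close> gives \<open>ln det N' - ln det N \<le> tr (N' E) - s\<close>, and replacing
  the MMSE receiver by the receiver \<open>U = T'\<^sup>-\<^sup>1 G'\<close> of the base point only increases the error
  covariance, by \<open>(U - T\<^sup>-\<^sup>1 G)\<^sup>H T (U - T\<^sup>-\<^sup>1 G)\<close>.\<close>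
lemma rate_lower_bound:
  assumes F: "pos_def M F" and G: "G \<in> carrier_mat M s"
    and F': "pos_def M F'" and G': "G' \<in> carrier_mat M s"
  defines "B \<equiv> G'\<^sup>H * minv F'"
  defines "A \<equiv> minv (F' + G' * G'\<^sup>H) * (G' * B)"
  shows "ln (Re (det (1\<^sub>m s + G'\<^sup>H * (minv F' * G')))) - Re (mtrace (G'\<^sup>H * (minv F' * G')))
      + 2 * Re (mtrace (B * G)) - Re (mtrace (A * (F + G * G\<^sup>H)))
    \<le> ln (Re (det (1\<^sub>m s + G\<^sup>H * (minv F * G))))"
    and "A\<^sup>H = A" "dim_row A = M" "dim_col A = M"
    and "mtrace (A * (F' + G' * G'\<^sup>H)) = mtrace (B * G')"
proof -
  interpret x: signal_model M s F G by unfold_locales fact+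
  interpret y: signal_model M s F' G' by unfold_locales fact+
  define U where "U = minv y.T * G'"
  define E where "E = minv x.N"
  define D where "D = 1\<^sub>m s - E"
  define Z where "Z = U - minv x.T * G"
  note dims = x.dims y.dims
  have dimU: "dim_row U = M" "dim_col U = s" by (simp_all add: U_def dims)
  have dimB: "dim_row B = s" "dim_col B = M" by (simp_all add: B_def dims)
  \<comment> \<open>This links the coefficients to the receiver: \<open>A\<close> becomes
    \<open>U * y.N * U\<^sup>H\<close>, which is visibly Hermitian, and weighting by
    \<open>y.N\<close> will turn \<open>U\<^sup>H\<close> into \<open>B\<close>.\<close>
  have UN: "y.N * U\<^sup>H = B"
    unfolding U_def B_def using y.N_minv_T by (simp add: mat_adjoint_mult dims y.hermitian)
  have A_eq: "A = U * B"
    unfolding A_def U_def y.T_def[symmetric] by (simp add: mat_mult_assoc_dim dims dimB)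
  show "A\<^sup>H = A"
    unfolding A_eq UN[symmetric] by (simp add: mat_ring_simps dims dimU y.hermitian)
  show "dim_row A = M" "dim_col A = M" by (simp_all add: A_eq dimU dimB)
  have "mtrace (A * y.T) = mtrace (y.T * minv y.T * (G' * B))"
    unfolding A_eq U_def by (subst mtrace_comm) (simp_all add: mat_mult_assoc_dim dims dimB)
  also have "\<dots> = mtrace (G' * B)" by (simp add: y.minv_T dims)
  also have "\<dots> = mtrace (B * G')" by (rule mtrace_comm) (simp_all add: dims dimB)
  finally show "mtrace (A * (F' + G' * G'\<^sup>H)) = mtrace (B * G')" unfolding y.T_def .

  have dimZ: "Z \<in> carrier_mat M s" by (auto simp: Z_def dims dimU)
  have TZ: "x.T * Z = x.T * U - G"
  proof -
    have "x.T * Z = x.T * U - x.T * minv x.T * G"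
      unfolding Z_def by (simp add: mat_mult_minus_dim mat_mult_assoc_dim dims dimU)
    thus ?thesis by (simp add: x.minv_T dims)
  qed
  have GT: "G\<^sup>H * (minv x.T * (x.T * U)) = G\<^sup>H * U"
  proof -
    have "minv x.T * (x.T * U) = minv x.T * x.T * U" by (simp add: mat_mult_assoc_dim dims dimU)
    thus ?thesis by (simp add: x.minv_T dimU)
  qed
  \<comment> \<open>Since \<open>D\<close> is the identity minus \<open>E\<close>, the right-hand
    side is the error covariance of the receiver \<open>U\<close>, namely \<open>1\<^sub>m s -
    U\<^sup>H * G - G\<^sup>H * U + U\<^sup>H * x.T * U\<close>, minus the optimal one
    \<open>E\<close>.\<close>
  have ZTZ: "Z\<^sup>H * (x.T * Z) = (U\<^sup>H * (x.T * U) - G\<^sup>H * U) - (U\<^sup>H * G - D)"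
  proof -
    have "D = G\<^sup>H * (minv x.T * G)"
      unfolding D_def E_def x.minv_N_eq by (intro eq_matI) (auto simp: dims)
    thus ?thesis unfolding TZ
      by (simp add: Z_def mat_ring_simps dims dimU x.hermitian GT)
  qed
  have dimE: "dim_row E = s" "dim_col E = s" by (simp_all add: E_def dims)
  have dimD: "dim_row D = s" "dim_col D = s" by (simp_all add: D_def dimE)
  \<comment> \<open>Weighted by \<open>y.N\<close>, the four pieces of \<open>ZTZ\<close> become the
    traces of the bound, up to cyclic permutation and adjoints. The \<open>s\<close> produced by
    \<open>t4\<close> later cancels the \<open>- s\<close> of the log-determinant
    inequality.\<close>
  have t1: "mtrace (y.N * (U\<^sup>H * (x.T * U))) = mtrace (A * x.T)"
  proof -
    have "y.N * (U\<^sup>H * (x.T * U)) = y.N * U\<^sup>H * (x.T * U)"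
      by (simp add: mat_mult_assoc_dim dims dimU)
    hence "mtrace (y.N * (U\<^sup>H * (x.T * U))) = mtrace (B * x.T * U)"
      unfolding UN by (simp add: mat_mult_assoc_dim dims dimU dimB)
    also have "\<dots> = mtrace (A * x.T)"
      unfolding A_eq by (subst mtrace_comm) (simp_all add: mat_mult_assoc_dim dims dimU dimB)
    finally show ?thesis .
  qed
  have t2: "mtrace (y.N * (U\<^sup>H * G)) = mtrace (B * G)"
    unfolding UN[symmetric] by (simp add: mat_mult_assoc_dim dims dimU)
  have t3: "mtrace (y.N * (G\<^sup>H * U)) = cnj (mtrace (B * G))"
  proof -
    have "mtrace (y.N * (G\<^sup>H * U)) = mtrace (G\<^sup>H * (U * y.N))"
      by (subst mtrace_comm) (simp_all add: mat_mult_assoc_dim dims dimU)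
    also have "\<dots> = mtrace ((y.N * U\<^sup>H * G)\<^sup>H)"
      by (simp add: mat_ring_simps dims dimU y.hermitian)
    finally show ?thesis unfolding UN by (simp add: mtrace_adjoint dims dimB)
  qed
  have t4: "mtrace (y.N * D) = s + mtrace (G'\<^sup>H * (minv F' * G')) - mtrace (y.N * E)"
    unfolding D_def by (simp add: mat_mult_minus_dim mtrace_minus dims dimE)
       (simp add: y.N_def mtrace_add dims)
  have "0 \<le> Re (mtrace (y.N * (Z\<^sup>H * (x.T * Z))))"
    by (intro mtrace_mult_nonneg[OF y.N_pos_def] pos_semidef_congruence[OF _ dimZ]
        pos_def_imp_pos_semidef[OF x.T_pos_def])
  also have "mtrace (y.N * (Z\<^sup>H * (x.T * Z))) = mtrace (y.N * (U\<^sup>H * (x.T * U)))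
      - mtrace (y.N * (G\<^sup>H * U)) - (mtrace (y.N * (U\<^sup>H * G)) - mtrace (y.N * D))"
    unfolding ZTZ by (simp add: mat_mult_minus_dim mtrace_minus dims dimU dimD)
  also note t1 also note t2 also note t3 also note t4
  finally have mmse: "Re (mtrace (y.N * E))
      \<le> Re (mtrace (A * x.T)) - 2 * Re (mtrace (B * G)) + s + Re (mtrace (G'\<^sup>H * (minv F' * G')))"
    by simp

  have E: "pos_def s E" unfolding E_def by (rule pos_def_minv[OF x.N_pos_def])
  note NE = ln_det_mult_le[OF y.N_pos_def E]
  \<comment> \<open>As \<open>E\<close> is the inverse of \<open>x.N\<close>, the difference of the
    two log-determinants is the logarithm of the determinant of \<open>y.N * E\<close>.\<close>
  have "y.N * E * x.N = y.N"
    by (simp add: mat_mult_assoc_dim dims dimE) (simp add: E_def x.minv_N dims)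
  hence "det (y.N * E) * det x.N = det y.N"
    using det_mult[of "y.N * E" s x.N] pos_defD(1)[OF y.N_pos_def] pos_defD(1)[OF x.N_pos_def]
      pos_defD(1)[OF E] by simp
  \<comment> \<open>\<open>Re\<close> is multiplicative here because the determinant of
    \<open>y.N * E\<close> is real.\<close>
  hence "Re (det y.N) = Re (det (y.N * E)) * Re (det x.N)"
    using NE(1) by (metis diff_zero mult_zero_left times_complex.sel(1))
  hence "ln (Re (det y.N)) = ln (Re (det (y.N * E))) + ln (Re (det x.N))"
    using NE(2) pos_def_det_pos(2)[OF x.N_pos_def] by (simp add: ln_mult)
  with NE(3) mmse
  have "ln (Re (det y.N)) - Re (mtrace (G'\<^sup>H * (minv F' * G')))
      + 2 * Re (mtrace (B * G)) - Re (mtrace (A * x.T)) \<le> ln (Re (det x.N))" by linarith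
  thus "ln (Re (det (1\<^sub>m s + G'\<^sup>H * (minv F' * G')))) - Re (mtrace (G'\<^sup>H * (minv F' * G')))
      + 2 * Re (mtrace (B * G)) - Re (mtrace (A * (F + G * G\<^sup>H)))
    \<le> ln (Re (det (1\<^sub>m s + G\<^sup>H * (minv F * G))))"
    unfolding x.N_def y.N_def x.T_def .
qed

section \<open>Eigenvalue bounds for Hermitian matrices\<close>

lemma frob_norm_minus_sq:
  assumes "dim_row A = dim_row B" "dim_col A = dim_col B"
  shows "(frob_norm (A - B))\<^sup>2 = (frob_norm A)\<^sup>2 - 2 * Re (mtrace (A\<^sup>H * B)) + (frob_norm B)\<^sup>2"
proof -
  have "mtrace (B\<^sup>H * A) = cnj (mtrace (A\<^sup>H * B))"
    using mtrace_adjoint[of "A\<^sup>H * B"] assms by (simp add: mat_adjoint_mult)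
  thus ?thesis using assms by (simp add: frob_norm_sq mat_expand)
qed

text \<open>The constant comes from expanding the square of \<open>frob_norm (Z - A * Z)\<close>,
  which is nonnegative, and bounding \<open>frob_norm (A * Z)\<close> by submultiplicativity. It is
  crude, but always positive, so that later arguments may divide by it.\<close>

lemma hermitian_form_le:
  assumes "dim_row A = n" "dim_col A = n" "dim_row Z = n"
  shows "Re (mtrace (Z\<^sup>H * (A * Z))) \<le> (1 + (frob_norm A)\<^sup>2) / 2 * (frob_norm Z)\<^sup>2"
proof -
  have "frob_norm (A * Z) \<le> frob_norm A * frob_norm Z"
    using assms by (intro frob_norm_mult_le) simp
  hence "(frob_norm (A * Z))\<^sup>2 \<le> (frob_norm A)\<^sup>2 * (frob_norm Z)\<^sup>2"
    by (metis frob_norm_nonneg power_mono power_mult_distrib)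
  moreover have "0 \<le> (frob_norm (Z - A * Z))\<^sup>2" by simp
  hence "2 * Re (mtrace (Z\<^sup>H * (A * Z))) \<le> (frob_norm Z)\<^sup>2 + (frob_norm (A * Z))\<^sup>2"
    using assms by (subst (asm) frob_norm_minus_sq) auto
  ultimately show ?thesis by (simp add: algebra_simps)
qed

text \<open>Nonnegativity of the form at \<open>Z - (1 / c) A Z\<close>, a gradient step with step
  length \<open>1 / c\<close>: the cross terms contribute \<open>- 2 / c\<close> times the squared
  norm of \<open>A * Z\<close>, and \<open>hermitian_form_le\<close> limits the last term to half of
  that.\<close>

lemma pos_semidef_image_le:
  assumes A: "pos_semidef n A" and Z: "dim_row Z = n"
  shows "(frob_norm (A * Z))\<^sup>2 \<le> (1 + (frob_norm A)\<^sup>2) / 2 * Re (mtrace (Z\<^sup>H * (A * Z)))"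
proof -
  note d = pos_semidefD(2,3,4)[OF A]
  define c where "c = (1 + (frob_norm A)\<^sup>2) / 2"
  define Y where "Y = A * Z"
  have c: "0 < c" unfolding c_def by (simp add: add_pos_nonneg)
  have dimY: "dim_row Y = n" "dim_col Y = dim_col Z" by (simp_all add: Y_def d)
  have "0 \<le> Re (mtrace ((Z - complex_of_real (1 / c) \<cdot>\<^sub>m Y)\<^sup>H
      * (A * (Z - complex_of_real (1 / c) \<cdot>\<^sub>m Y))))"
    using Z dimY by (intro pos_semidefD(5)[OF A]) simp
  also have "\<dots> = Re (mtrace (Z\<^sup>H * (A * Z))) - 1 / c * Re (mtrace (Y\<^sup>H * (A * Z)))
      - 1 / c * Re (mtrace (Z\<^sup>H * (A * Y))) + (1 / c)\<^sup>2 * Re (mtrace (Y\<^sup>H * (A * Y)))"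
    using Z dimY d by (simp add: mat_expand power2_eq_square algebra_simps)
  also have "mtrace (Y\<^sup>H * (A * Z)) = complex_of_real ((frob_norm Y)\<^sup>2)"
    by (simp only: Y_def mtrace_gram)
  also have "mtrace (Z\<^sup>H * (A * Y)) = mtrace (Y\<^sup>H * Y)"
    using Z d by (simp add: Y_def mat_ring_simps)
  also have "mtrace (Y\<^sup>H * Y) = complex_of_real ((frob_norm Y)\<^sup>2)" by (rule mtrace_gram)
  finally have "0 \<le> Re (mtrace (Z\<^sup>H * (A * Z))) - 2 * (1 / c) * (frob_norm Y)\<^sup>2
      + (1 / c)\<^sup>2 * Re (mtrace (Y\<^sup>H * (A * Y)))" by (simp del: of_real_power)
  also have "(1 / c)\<^sup>2 * Re (mtrace (Y\<^sup>H * (A * Y))) \<le> (1 / c)\<^sup>2 * (c * (frob_norm Y)\<^sup>2)"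
    using hermitian_form_le[of A n Y] d dimY c by (intro mult_left_mono) (auto simp: c_def)
  also have "\<dots> = 1 / c * (frob_norm Y)\<^sup>2" using c by (simp add: power2_eq_square)
  finally have "1 / c * (frob_norm Y)\<^sup>2 \<le> Re (mtrace (Z\<^sup>H * (A * Z)))" by simp
  thus ?thesis using c by (simp add: c_def[symmetric] Y_def[symmetric] field_simps)
qed

text \<open>Writing \<open>Z\<close> as \<open>minv A * (A * Z)\<close> bounds its norm by that of
  \<open>A * Z\<close>, which \<open>pos_semidef_image_le\<close> bounds by the form. The result
  replaces a positive lower bound on the spectrum.\<close>

lemma pos_semidef_coercive:
  assumes A: "pos_semidef n A" and det: "det A \<noteq> 0"
  obtains d where "0 < d"
    "\<And>Z. dim_row Z = n \<Longrightarrow> (frob_norm Z)\<^sup>2 \<le> d * Re (mtrace (Z\<^sup>H * (A * Z)))"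
proof
  note inv = minv_inverse[OF pos_semidefD(1)[OF A] det]
  define c where "c = (1 + (frob_norm A)\<^sup>2) / 2"
  \<comment> \<open>The summand 1 keeps the constant positive also for \<open>n = 0\<close>, where
    the norm of the inverse is 0.\<close>
  let ?d = "(frob_norm (minv A))\<^sup>2 * c + 1"
  have c: "0 < c" unfolding c_def by (simp add: add_pos_nonneg)
  thus "0 < ?d" by (simp add: add_nonneg_pos)
  fix Z :: "complex mat" assume Z: "dim_row Z = n"
  have "Z = minv A * (A * Z)"
    using Z inv pos_semidefD(3,4)[OF A] by (simp flip: mat_mult_assoc_dim)
  hence "frob_norm Z \<le> frob_norm (minv A) * frob_norm (A * Z)"
    using frob_norm_mult_le[of "minv A" "A * Z"] inv pos_semidefD(3,4)[OF A] by simp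
  hence "(frob_norm Z)\<^sup>2 \<le> (frob_norm (minv A))\<^sup>2 * (frob_norm (A * Z))\<^sup>2"
    by (metis frob_norm_nonneg power_mono power_mult_distrib)
  also have "\<dots> \<le> (frob_norm (minv A))\<^sup>2 * (c * Re (mtrace (Z\<^sup>H * (A * Z))))"
    using pos_semidef_image_le[OF A Z] by (intro mult_left_mono) (auto simp: c_def)
  also have "\<dots> \<le> ?d * Re (mtrace (Z\<^sup>H * (A * Z)))"
    using pos_semidefD(5)[OF A Z] by (simp add: algebra_simps)
  finally show "(frob_norm Z)\<^sup>2 \<le> ?d * Re (mtrace (Z\<^sup>H * (A * Z)))" .
qed

text \<open>Otherwise the infimum \<open>t\<close> of all shifts for which \<open>(\<eta> + t) I - S\<close> is positive
  semidefinite is positive; as \<open>\<eta> + t\<close> is not an eigenvalue, the shifted matrix is coercive and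
  \<open>t\<close> can be decreased.\<close>
lemma eigenvalue_bound_pos_semidef:
  assumes S: "S \<in> carrier_mat n n" "S\<^sup>H = S"
    and ev: "\<And>r. eigenvalue S (complex_of_real r) \<Longrightarrow> r \<le> \<eta>"
  shows "pos_semidef n (complex_of_real \<eta> \<cdot>\<^sub>m 1\<^sub>m n - S)"
proof -
  define L where "L t = complex_of_real (\<eta> + t) \<cdot>\<^sub>m 1\<^sub>m n - S" for t
  define q where "q Z = Re (mtrace (Z\<^sup>H * (S * Z)))" for Z
  define J where "J = {t. 0 \<le> t \<and> (\<forall>Z. dim_row Z = n \<longrightarrow> q Z \<le> (\<eta> + t) * (frob_norm Z)\<^sup>2)}"
  have form: "Re (mtrace (Z\<^sup>H * (L t * Z))) = (\<eta> + t) * (frob_norm Z)\<^sup>2 - q Z"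
    if "dim_row Z = n" for t Z
    using that S unfolding L_def q_def
    by (simp add: mat_expand mtrace_gram del: of_real_add of_real_power)
  have L: "pos_semidef n (L t)" if "t \<in> J" for t
    unfolding pos_semidef_def
  proof (intro conjI allI ballI)
    show "L t \<in> carrier_mat n n" "(L t)\<^sup>H = L t"
      using S by (auto simp: L_def mat_ring_simps)
    fix m and Z :: "complex mat" assume "Z \<in> carrier_mat n m"
    with that show "0 \<le> Re (mtrace (Z\<^sup>H * (L t * Z)))"
      by (simp add: form J_def)
  qed
  define c where "c = (1 + (frob_norm S)\<^sup>2) / 2"
  have c: "q Z \<le> c * (frob_norm Z)\<^sup>2" if "dim_row Z = n" for Z
    unfolding q_def c_def using S that by (intro hermitian_form_le) auto
  have "q Z \<le> (\<eta> + max 0 (c - \<eta>)) * (frob_norm Z)\<^sup>2" if "dim_row Z = n" for Z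
    using c[OF that] by (rule order_trans) (intro mult_right_mono, auto)
  hence ne: "max 0 (c - \<eta>) \<in> J" by (auto simp: J_def)
  have bdd: "bdd_below J" by (rule bdd_belowI[of _ 0]) (auto simp: J_def)
  define t where "t = Inf J"
  have "0 \<le> t" unfolding t_def
    by (rule cInf_greatest) (use ne in blast, simp add: J_def)
  \<comment> \<open>The infimum belongs to \<open>J\<close>: for each \<open>Z\<close> of nonzero
    norm the condition is a closed lower bound on the shift, and for norm zero it does not depend on
    the shift.\<close>
  have "q Z \<le> (\<eta> + t) * (frob_norm Z)\<^sup>2" if Z: "dim_row Z = n" for Z
  proof (cases "frob_norm Z = 0")
    case True
    thus ?thesis using ne Z by (auto simp: J_def)
  next
    case False
    have "q Z / (frob_norm Z)\<^sup>2 - \<eta> \<le> t"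
      unfolding t_def
    proof (rule cInf_greatest)
      fix u assume "u \<in> J"
      with Z have "q Z \<le> (\<eta> + u) * (frob_norm Z)\<^sup>2" by (auto simp: J_def)
      with False show "q Z / (frob_norm Z)\<^sup>2 - \<eta> \<le> u" by (simp add: field_simps)
    qed (use ne in auto)
    with False show ?thesis by (simp add: field_simps)
  qed
  with \<open>0 \<le> t\<close> have tJ: "t \<in> J" by (auto simp: J_def)
  have "t = 0"
  proof (rule ccontr)
    assume "t \<noteq> 0"
    with \<open>0 \<le> t\<close> have "0 < t" by simp
    have "det (L t) \<noteq> 0"
    proof
      assume "det (L t) = 0"
      have "char_matrix S (complex_of_real (\<eta> + t)) = (-1) \<cdot>\<^sub>m L t"
        unfolding char_matrix_def L_def using S by (intro eq_matI) auto
      hence "det (char_matrix S (complex_of_real (\<eta> + t))) = 0"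
        using \<open>det (L t) = 0\<close> by (simp add: det_smult)
      hence "eigenvalue S (complex_of_real (\<eta> + t))" using eigenvalue_det[OF S(1)] by blast
      with ev[of "\<eta> + t"] \<open>0 < t\<close> show False by simp
    qed
    then obtain d where d: "0 < d"
      "\<And>Z. dim_row Z = n \<Longrightarrow> (frob_norm Z)\<^sup>2 \<le> d * Re (mtrace (Z\<^sup>H * (L t * Z)))"
      using pos_semidef_coercive[OF L[OF tJ]] by blast
    \<comment> \<open>Coercivity leaves a slack of \<open>1 / d\<close> times the squared norm, so
      the shift can drop by \<open>1 / d\<close>; the maximum with 0 respects the sign condition in
      \<open>J\<close>.\<close>
    have "q Z \<le> (\<eta> + max 0 (t - 1 / d)) * (frob_norm Z)\<^sup>2" if Z: "dim_row Z = n" for Z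
    proof -
      have "q Z \<le> (\<eta> + (t - 1 / d)) * (frob_norm Z)\<^sup>2"
        using d(2)[OF Z] d(1) by (simp add: form[OF Z] field_simps)
      also have "\<dots> \<le> (\<eta> + max 0 (t - 1 / d)) * (frob_norm Z)\<^sup>2"
        by (intro mult_right_mono) auto
      finally show ?thesis .
    qed
    hence "max 0 (t - 1 / d) \<in> J" by (auto simp: J_def)
    hence "t \<le> max 0 (t - 1 / d)" unfolding t_def using bdd by (rule cInf_lower)
    with \<open>0 < t\<close> d(1) show False by (auto simp: max_def split: if_splits)
  qed
  with L[OF tJ] show ?thesis by (simp add: L_def)
qed

text \<open>\<open>Max\<close> dominates its members only on a finite set; finiteness holds because
  eigenvalues are roots of a nonzero characteristic polynomial.\<close>

lemma lambda_max_pos_semidef: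
  assumes S: "S \<in> carrier_mat n n" "S\<^sup>H = S" and le: "lambda_max S \<le> \<eta>"
  shows "pos_semidef n (complex_of_real \<eta> \<cdot>\<^sub>m 1\<^sub>m n - S)"
proof (rule eigenvalue_bound_pos_semidef[OF S])
  fix r assume r: "eigenvalue S (complex_of_real r)"
  have "char_poly S \<noteq> 0" using degree_monic_char_poly[OF S(1)] by auto
  hence "finite {e. eigenvalue S e}"
    unfolding eigenvalue_root_char_poly[OF S(1)] by (rule poly_roots_finite)
  hence "finite (complex_of_real -` {e. eigenvalue S e})"
    by (rule finite_vimageI) (simp add: inj_on_def)
  hence "r \<le> lambda_max S" unfolding lambda_max_def using r by (intro Max_ge) (auto simp: vimage_def)
  with le show "r \<le> \<eta>" by simp
qed

section \<open>The surrogate function\<close>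

lemma msum_dims [simp]: "dim_row (msum r c X J) = r" "dim_col (msum r c X J) = c"
  by (simp_all add: msum_def)

lemma msum_adjoint:
  assumes "\<And>j. j \<in> J \<Longrightarrow> X j \<in> carrier_mat r c"
  shows "(msum r c X J)\<^sup>H = msum c r (\<lambda>j. (X j)\<^sup>H) J"
proof (rule eq_matI)
  fix a b assume "a < dim_row (msum c r (\<lambda>j. (X j)\<^sup>H) J)" "b < dim_col (msum c r (\<lambda>j. (X j)\<^sup>H) J)"
  hence ab: "a < c" "b < r" by auto
  have "(\<Sum>j\<in>J. cnj (X j $$ (b, a))) = (\<Sum>j\<in>J. (X j)\<^sup>H $$ (a, b))"
    using carrier_matD[OF assms] ab by (intro sum.cong) simp_all
  with ab show "(msum r c X J)\<^sup>H $$ (a, b) = msum c r (\<lambda>j. (X j)\<^sup>H) J $$ (a, b)"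
    by (simp add: msum_def)
qed auto

lemma mtrace_mult_msum:
  assumes "A \<in> carrier_mat n n" and X: "\<And>j. j \<in> J \<Longrightarrow> X j \<in> carrier_mat n n"
  shows "mtrace (A * msum n n X J) = (\<Sum>j\<in>J. mtrace (A * X j))"
proof -
  have "mtrace (A * msum n n X J) = (\<Sum>a<n. \<Sum>b<n. \<Sum>j\<in>J. A $$ (a, b) * X j $$ (b, a))"
    using assms(1) by (subst mtrace_mult_entries) (auto simp: msum_def sum_distrib_left)
  also have "\<dots> = (\<Sum>a<n. \<Sum>j\<in>J. \<Sum>b<n. A $$ (a, b) * X j $$ (b, a))"
    by (intro sum.cong refl sum.swap)
  also have "\<dots> = (\<Sum>j\<in>J. \<Sum>a<n. \<Sum>b<n. A $$ (a, b) * X j $$ (b, a))"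
    by (rule sum.swap)
  also have "\<dots> = (\<Sum>j\<in>J. mtrace (A * X j))"
    using carrier_matD[OF assms(1)] carrier_matD[OF X]
    by (intro sum.cong refl, subst mtrace_mult_entries) simp_all
  finally show ?thesis .
qed

lemma mtrace_form:
  assumes "dim_row Z = n" "dim_row A = n" "dim_col A = n"
  shows "mtrace (Z\<^sup>H * (A * Z)) = mtrace (Z * Z\<^sup>H * A)"
  using assms mtrace_comm[of "Z\<^sup>H * A" Z] by (simp add: mat_mult_assoc_dim)

lemma mtrace_form_msum:
  assumes Z: "dim_row Z = n" and X: "\<And>j. j \<in> J \<Longrightarrow> X j \<in> carrier_mat n n"
  shows "mtrace (Z\<^sup>H * (msum n n X J * Z)) = (\<Sum>j\<in>J. mtrace (Z\<^sup>H * (X j * Z)))"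
proof -
  have "Z * Z\<^sup>H \<in> carrier_mat n n" using Z by (intro carrier_matI) simp_all
  with X have "mtrace (Z\<^sup>H * (msum n n X J * Z)) = (\<Sum>j\<in>J. mtrace (Z * Z\<^sup>H * X j))"
    using Z by (subst mtrace_form[where n = n]) (simp_all add: mtrace_mult_msum)
  also have "\<dots> = (\<Sum>j\<in>J. mtrace (Z\<^sup>H * (X j * Z)))"
    using carrier_matD[OF X] Z by (intro sum.cong refl mtrace_form[where n = n, symmetric]) simp_all
  finally show ?thesis .
qed

lemma pos_semidef_msum:
  assumes "\<And>j. j \<in> J \<Longrightarrow> pos_semidef n (X j)"
  shows "pos_semidef n (msum n n X J)"
  unfolding pos_semidef_def
proof (intro conjI allI ballI)
  have X: "X j \<in> carrier_mat n n" if "j \<in> J" for j using pos_semidefD(1) assms that by blast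
  show "msum n n X J \<in> carrier_mat n n" by auto
  have "msum n n (\<lambda>j. (X j)\<^sup>H) J = msum n n X J"
    unfolding msum_def using pos_semidefD(2)[OF assms] by (intro cong_mat refl) auto
  thus "(msum n n X J)\<^sup>H = msum n n X J" using msum_adjoint[OF X] by simp
  fix m and Z :: "complex mat" assume "Z \<in> carrier_mat n m"
  thus "0 \<le> Re (mtrace (Z\<^sup>H * (msum n n X J * Z)))"
    using pos_semidefD(5)[OF assms] X by (subst mtrace_form_msum) (auto intro!: sum_nonneg)
qed

lemma pos_def_smult:
  assumes A: "pos_def n A" and c: "0 < c"
  shows "pos_def n (complex_of_real c \<cdot>\<^sub>m A)"
  unfolding pos_def_def
proof (intro conjI allI ballI impI)
  note d = pos_defD(1-4)[OF A]
  show "complex_of_real c \<cdot>\<^sub>m A \<in> carrier_mat n n"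
    "(complex_of_real c \<cdot>\<^sub>m A)\<^sup>H = complex_of_real c \<cdot>\<^sub>m A"
    using d by (auto simp: mat_adjoint_smult)
  fix m and Z :: "complex mat" assume Z: "Z \<in> carrier_mat n m" "Z \<noteq> 0\<^sub>m n m"
  thus "0 < Re (mtrace (Z\<^sup>H * (complex_of_real c \<cdot>\<^sub>m A * Z)))"
    using pos_defD(5)[OF A Z] c d by (simp add: mat_expand)
qed

text \<open>In the expansion of the last form, \<open>W\<^sup>H * D * W\<close> cancels
  \<open>W\<^sup>H * S * W\<close> except for the scalar part with \<eta>. The two cross terms are
  conjugates of each other because \<open>S\<close> is Hermitian.\<close>

lemma majorizer_eq:
  fixes W V S :: "complex mat" and \<eta> :: real
  assumes W: "W \<in> carrier_mat n s" and V: "V \<in> carrier_mat n s"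
    and S: "S \<in> carrier_mat n n" "S\<^sup>H = S"
  defines "D \<equiv> complex_of_real \<eta> \<cdot>\<^sub>m 1\<^sub>m n - S"
  shows "Re (mtrace (complex_of_real \<eta> \<cdot>\<^sub>m (W\<^sup>H * W)
        + two_Re (W\<^sup>H * (S - complex_of_real \<eta> \<cdot>\<^sub>m 1\<^sub>m n) * V) + V\<^sup>H * D * V))
    = Re (mtrace (W\<^sup>H * (S * W))) + Re (mtrace ((W - V)\<^sup>H * (D * (W - V))))"
proof -
  have 1: "mtrace (V\<^sup>H * (S * W)) = cnj (mtrace (W\<^sup>H * (S * V)))"
    using mtrace_adjoint[of "W\<^sup>H * (S * V)"] W V S by (simp add: mat_ring_simps)
  have 2: "mtrace (V\<^sup>H * W) = cnj (mtrace (W\<^sup>H * V))"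
    using mtrace_adjoint[of "W\<^sup>H * V"] W V by (simp add: mat_ring_simps)
  show ?thesis
    using W V S by (simp add: two_Re_def D_def mat_expand 1 2 algebra_simps)
qed

text \<open>\<open>Q\<close> is the stationary point of the left-hand side: the gradient condition
  is \<open>\<eta> W + R V = \<omega> H\<^sup>H B\<^sup>H\<close>.\<close>

lemma complete_square:
  fixes W V S B H :: "complex mat" and \<eta> \<omega> :: real
  assumes W: "W \<in> carrier_mat n s" and V: "V \<in> carrier_mat n s"
    and S: "S \<in> carrier_mat n n" and B: "B \<in> carrier_mat s m" and H: "H \<in> carrier_mat m n"
    and \<eta>: "0 < \<eta>"
  defines "R \<equiv> S - complex_of_real \<eta> \<cdot>\<^sub>m 1\<^sub>m n"
  defines "Q \<equiv> complex_of_real (inverse \<eta>) \<cdot>\<^sub>m (complex_of_real \<omega> \<cdot>\<^sub>m (H\<^sup>H * B\<^sup>H) - R * V)"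
  shows "\<eta> * (frob_norm W)\<^sup>2 + 2 * Re (mtrace (W\<^sup>H * (R * V))) - 2 * \<omega> * Re (mtrace (B * H * W))
    = \<eta> * (frob_norm (W - Q))\<^sup>2 - \<eta> * (frob_norm Q)\<^sup>2"
proof -
  have R: "dim_row R = n" "dim_col R = n" unfolding R_def using S by auto
  have "mtrace (W\<^sup>H * (H\<^sup>H * B\<^sup>H)) = cnj (mtrace (B * H * W))"
    using mtrace_adjoint[of "B * H * W"] W B H by (simp add: mat_ring_simps)
  hence WQ: "mtrace (W\<^sup>H * Q)
      = complex_of_real (inverse \<eta>) * (complex_of_real \<omega> * cnj (mtrace (B * H * W)) - mtrace (W\<^sup>H * (R * V)))"
    unfolding Q_def using W V B H R by (simp add: mat_mult_smult_dim mat_mult_minus_dim mtrace_simps)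
  have "dim_row Q = n" "dim_col Q = s" unfolding Q_def using H B R V by auto
  hence "(frob_norm (W - Q))\<^sup>2 = (frob_norm W)\<^sup>2 - 2 * Re (mtrace (W\<^sup>H * Q)) + (frob_norm Q)\<^sup>2"
    using W by (intro frob_norm_minus_sq) auto
  thus ?thesis unfolding WQ using \<eta> by (simp add: field_simps)
qed

section \<open>Projection onto a Frobenius ball\<close>

lemma frob_norm_smult_sq: "(frob_norm (complex_of_real c \<cdot>\<^sub>m A))\<^sup>2 = c\<^sup>2 * (frob_norm A)\<^sup>2"
  unfolding frob_norm_sq by (simp add: mat_expand power2_eq_square)

text \<open>The nearest point of the ball is found by radial scaling. The strict inequality makes it
  the only one. For \<open>Q = 0\<close> division by zero gives \<open>c = 0\<close>, and the scaled
  matrix is zero as intended.\<close>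

lemma ball_projection:
  fixes Q W :: "complex mat" and P :: real
  assumes P: "0 < P"
  defines "c \<equiv> min (sqrt (P / (frob_norm Q)\<^sup>2)) 1"
  shows "(frob_norm (complex_of_real c \<cdot>\<^sub>m Q))\<^sup>2 \<le> P"
    and "\<lbrakk>dim_row W = dim_row Q; dim_col W = dim_col Q; (frob_norm W)\<^sup>2 \<le> P;
      W \<noteq> complex_of_real c \<cdot>\<^sub>m Q\<rbrakk>
      \<Longrightarrow> (frob_norm (complex_of_real c \<cdot>\<^sub>m Q - Q))\<^sup>2 < (frob_norm (W - Q))\<^sup>2"
proof -
  define q where "q = (frob_norm Q)\<^sup>2"
  have c_def: "c = min (sqrt (P / q)) 1" by (simp add: c_def q_def)
  have c0: "0 \<le> c" "c \<le> 1" using P by (auto simp: c_def q_def)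
  consider (zero) "q = 0" | (inside) "q > 0" "c = 1" "q \<le> P" | (outside) "q > 0" "0 < c" "c < 1" "c\<^sup>2 * q = P"
  proof -
    have "q \<ge> 0" by (simp add: q_def)
    moreover have "c = 1 \<and> q \<le> P" if "q > 0" "sqrt (P / q) \<ge> 1"
      using that by (auto simp: c_def)
    moreover have "0 < c \<and> c < 1 \<and> c\<^sup>2 * q = P" if "q > 0" "sqrt (P / q) < 1"
    proof -
      have "c = sqrt (P / q)" using that by (simp add: c_def)
      moreover have "c\<^sup>2 * q = P" unfolding calculation using that P by simp
      ultimately show ?thesis using that P by simp
    qed
    ultimately show thesis using that by linarith
  qed
  note cases = this
  show "(frob_norm (complex_of_real c \<cdot>\<^sub>m Q))\<^sup>2 \<le> P"
    unfolding frob_norm_smult_sq q_def[symmetric] by (cases rule: cases) (use P in auto)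
  assume dim: "dim_row W = dim_row Q" "dim_col W = dim_col Q"
    and WP: "(frob_norm W)\<^sup>2 \<le> P" and neq: "W \<noteq> complex_of_real c \<cdot>\<^sub>m Q"
  define a where "a = (frob_norm W)\<^sup>2"
  define r where "r = Re (mtrace (W\<^sup>H * Q))"
  \<comment> \<open>The positive distance from \<open>W\<close> to the candidate is the source of
    strictness in all three cases.\<close>
  have "frob_norm (W - complex_of_real c \<cdot>\<^sub>m Q) \<noteq> 0"
  proof
    assume "frob_norm (W - complex_of_real c \<cdot>\<^sub>m Q) = 0"
    hence "W - complex_of_real c \<cdot>\<^sub>m Q = 0\<^sub>m (dim_row Q) (dim_col Q)"
      by (simp add: frob_norm_eq_0)
    hence "(W - complex_of_real c \<cdot>\<^sub>m Q) $$ (i, j) = 0" if "i < dim_row Q" "j < dim_col Q" for i j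
      using that by simp
    hence "W = complex_of_real c \<cdot>\<^sub>m Q" using dim by (intro eq_matI) auto
    with neq show False ..
  qed
  hence "0 < (frob_norm (W - complex_of_real c \<cdot>\<^sub>m Q))\<^sup>2" by simp
  also have "\<dots> = a - 2 * c * r + c\<^sup>2 * q"
    using dim by (simp add: frob_norm_minus_sq frob_norm_smult_sq a_def r_def q_def
        mat_mult_smult_dim mtrace_smult)
  finally have \<delta>: "0 < a - 2 * c * r + c\<^sup>2 * q" .
  have WQ: "(frob_norm (W - Q))\<^sup>2 = a - 2 * r + q"
    using dim by (simp add: frob_norm_minus_sq a_def r_def q_def)
  have cQ: "(frob_norm (complex_of_real c \<cdot>\<^sub>m Q - Q))\<^sup>2 = (c - 1)\<^sup>2 * q"
  proof -
    have "complex_of_real c \<cdot>\<^sub>m Q - Q = complex_of_real (c - 1) \<cdot>\<^sub>m Q"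
      by (intro eq_matI) (auto simp: algebra_simps)
    thus ?thesis by (simp only: frob_norm_smult_sq q_def)
  qed
  show "(frob_norm (complex_of_real c \<cdot>\<^sub>m Q - Q))\<^sup>2 < (frob_norm (W - Q))\<^sup>2"
    unfolding WQ cQ
  proof (cases rule: cases)
    case zero
    hence Q: "Q = 0\<^sub>m (dim_row Q) (dim_col Q)" by (simp add: q_def frob_norm_eq_0)
    have "W\<^sup>H * Q = 0\<^sub>m (dim_col Q) (dim_col Q)"
      by (subst Q) (use dim in \<open>intro eq_matI; simp\<close>)
    hence "r = 0" by (simp add: r_def)
    with zero \<delta> show "(c - 1)\<^sup>2 * q < a - 2 * r + q" by simp
  next
    case inside
    with \<delta> show "(c - 1)\<^sup>2 * q < a - 2 * r + q" by simp
  next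
    case outside
    \<comment> \<open>With \<open>c\<^sup>2 * q = P\<close>, \<open>c\<close> times the gap to be
      proved positive equals this product plus the squared distance from \<open>W\<close> to the
      candidate.\<close>
    have "0 \<le> (1 - c) * (P - a)" using outside WP by (simp add: a_def)
    hence "0 < c * (a - 2 * r + q - (c - 1)\<^sup>2 * q)"
      using outside(4) \<delta> by (simp add: algebra_simps power2_eq_square)
    thus "(c - 1)\<^sup>2 * q < a - 2 * r + q" using outside(2) by (simp add: zero_less_mult_iff)
  qed
qed

section \<open>Minorants of the individual rates\<close>

locale weighted_sum_rate =
  fixes K :: nat and Mr Mt Ms :: "nat \<Rightarrow> nat" and H :: "nat \<Rightarrow> nat \<Rightarrow> complex mat"
    and \<sigma> \<omega> P \<eta> :: "nat \<Rightarrow> real" and V :: "nat \<Rightarrow> complex mat"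
  assumes H: "\<And>i j. i \<in> {1..K} \<Longrightarrow> j \<in> {1..K} \<Longrightarrow> H i j \<in> carrier_mat (Mr i) (Mt j)"
    and \<sigma>: "\<And>k. k \<in> {1..K} \<Longrightarrow> (\<sigma> k)\<^sup>2 > 0"
    and \<omega>: "\<And>k. k \<in> {1..K} \<Longrightarrow> \<omega> k > 0"
    and P: "\<And>k. k \<in> {1..K} \<Longrightarrow> P k > 0"
    and V: "V \<in> feasible K Mt Ms P"
    and \<eta>: "\<And>k. k \<in> {1..K} \<Longrightarrow> \<eta> k > 0"
    and \<eta>_ge: "\<And>k. k \<in> {1..K} \<Longrightarrow> \<eta> k \<ge> lambda_max (S_mat K Mr Mt H \<sigma> \<omega> V k)"
begin

abbreviation "X \<equiv> feasible K Mt Ms P"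
abbreviation "f \<equiv> sum_rate K Mr Ms H \<sigma> \<omega>"
abbreviation "l W \<equiv> ell' K Mr Mt Ms H \<sigma> \<omega> \<eta> W V"
abbreviation "F \<equiv> F_mat K Mr H \<sigma>"
abbreviation "A \<equiv> A_mat K Mr H \<sigma> V"
abbreviation "B \<equiv> B_mat K Mr H \<sigma> V"
abbreviation "R \<equiv> rate K Mr Ms H \<sigma>"
abbreviation "S \<equiv> S_mat K Mr Mt H \<sigma> \<omega> V"
abbreviation "Q \<equiv> Q_mat K Mr Mt H \<sigma> \<omega> \<eta> V"
abbreviation "D k \<equiv> complex_of_real (\<eta> k) \<cdot>\<^sub>m 1\<^sub>m (Mt k) - S k"

lemma X_D:
  assumes "W \<in> X" "k \<in> {1..K}"
  shows "W k \<in> carrier_mat (Mt k) (Ms k)" "(frob_norm (W k))\<^sup>2 \<le> P k"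
  using assms by (auto simp: feasible_def)

lemma H_dims:
  assumes "i \<in> {1..K}" "j \<in> {1..K}"
  shows "dim_row (H i j) = Mr i" "dim_col (H i j) = Mt j"
  using H[OF assms] by auto

lemma W_dims:
  assumes "W \<in> X" "k \<in> {1..K}"
  shows "dim_row (W k) = Mt k" "dim_col (W k) = Ms k"
  using X_D[OF assms] by auto

text \<open>The interference is a sum of Gram matrices; positive noise power makes the total
  strictly definite, hence invertible.\<close>

lemma F_pos_def:
  assumes W: "W \<in> X" and k: "k \<in> {1..K}"
  shows "pos_def (Mr k) (F W k)"
proof -
  let ?Y = "\<lambda>j. H k j * W j * (W j)\<^sup>H * (H k j)\<^sup>H"
  have "pos_semidef (Mr k) (?Y j)" if "j \<in> {1..K} - {k}" for j
  proof -
    from that have j: "j \<in> {1..K}" by simp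
    have "?Y j = (H k j * W j) * (H k j * W j)\<^sup>H"
      using W_dims[OF W j] H_dims[OF k j] by (simp add: mat_ring_simps)
    thus ?thesis
      using pos_semidef_gram[of "H k j * W j" "Mr k" "Ms j"] H[OF k j] X_D[OF W j] by auto
  qed
  hence psd: "pos_semidef (Mr k) (msum (Mr k) (Mr k) ?Y ({1..K} - {k}))"
    by (rule pos_semidef_msum)
  have pd: "pos_def (Mr k) (complex_of_real ((\<sigma> k)\<^sup>2) \<cdot>\<^sub>m 1\<^sub>m (Mr k))"
    by (intro pos_def_smult pos_def_one \<sigma> k)
  show ?thesis
    using pos_def_add_pos_semidef[OF pd psd] unfolding F_mat_def
    by (subst comm_add_mat[of _ "Mr k" "Mr k"]) (auto intro: pos_semidefD(1)[OF psd] pos_defD(1)[OF pd])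
qed

lemma minv_F_dims:
  assumes "W \<in> X" "k \<in> {1..K}"
  shows "dim_row (minv (F W k)) = Mr k" "dim_col (minv (F W k)) = Mr k"
  using pos_defD(3,4)[OF pos_def_minv[OF F_pos_def[OF assms]]] by auto

lemma rate_eq:
  assumes W: "W \<in> X" and k: "k \<in> {1..K}"
  defines "G \<equiv> H k k * W k"
  shows "R W k = ln (Re (det (1\<^sub>m (Ms k) + G\<^sup>H * (minv (F W k) * G))))"
  unfolding rate_def G_def using W_dims[OF W k] H_dims[OF k k] minv_F_dims[OF W k]
  by (simp add: mat_ring_simps)

context
  fixes k assumes k: "k \<in> {1..K}"
begin

definition G where "G = H k k * V k"

lemma G: "G \<in> carrier_mat (Mr k) (Ms k)"
  unfolding G_def using H[OF k k] X_D[OF V k] by auto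

lemmas dims = W_dims[OF V k] H_dims[OF k k] minv_F_dims[OF V k]

lemma B_eq: "B k = G\<^sup>H * minv (F V k)"
  unfolding B_mat_def G_def by (simp add: mat_adjoint_mult dims)

lemma A_eq: "A k = minv (F V k + G * G\<^sup>H) * (G * (G\<^sup>H * minv (F V k)))"
proof -
  have pd: "pos_def (Mr k) (F V k + G * G\<^sup>H)"
    by (intro pos_def_add_pos_semidef F_pos_def V k pos_semidef_gram[OF G])
  have eq: "H k k * V k * (V k)\<^sup>H * (H k k)\<^sup>H = G * G\<^sup>H"
    unfolding G_def by (simp add: mat_ring_simps dims)
  show ?thesis
    unfolding A_mat_def eq B_eq using pos_defD(3,4)[OF pos_def_minv[OF pd]] carrier_matD[OF G]
    by (simp add: G_def mat_mult_assoc_dim dims)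
qed

lemma B_carrier: "B k \<in> carrier_mat (Ms k) (Mr k)"
  unfolding B_eq using G by (auto simp: dims)

text \<open>These conclusions of \<open>rate_lower_bound\<close> concern the base point only, so
  both of its points are taken to be \<open>V\<close>.\<close>

lemma A_hermitian: "(A k)\<^sup>H = A k" "dim_row (A k) = Mr k" "dim_col (A k) = Mr k"
  unfolding A_eq using rate_lower_bound(2-4)[OF F_pos_def[OF V k] G F_pos_def[OF V k] G] by auto

text \<open>The link's own signal fills the index \<open>k\<close> left out of the interference, so
  the sum runs over all transmitters. The remaining noise part is the origin of the \<sigma> term in
  \<open>ell'\<close>.\<close>

lemma mtrace_A_total:
  assumes W: "W \<in> X"
  shows "mtrace (A k * (F W k + (H k k * W k) * (H k k * W k)\<^sup>H))
    = complex_of_real ((\<sigma> k)\<^sup>2) * mtrace (A k)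
      + (\<Sum>j = 1..K. mtrace ((W j)\<^sup>H * ((H k j)\<^sup>H * A k * H k j * W j)))"
proof -
  let ?Y = "\<lambda>j. H k j * W j * (W j)\<^sup>H * (H k j)\<^sup>H"
  let ?M = "msum (Mr k) (Mr k) ?Y ({1..K} - {k})"
  have Y: "?Y j \<in> carrier_mat (Mr k) (Mr k)" if "j \<in> {1..K}" for j
    using H[OF k that] X_D[OF W that] by auto
  have Yk: "?Y k = (H k k * W k) * (H k k * W k)\<^sup>H"
    using W_dims[OF W k] by (simp add: mat_ring_simps dims)
  have summand: "mtrace (A k * ?Y j) = mtrace ((W j)\<^sup>H * ((H k j)\<^sup>H * A k * H k j * W j))"
    if j: "j \<in> {1..K}" for j
  proof -
    note d = W_dims[OF W j] H_dims[OF k j] A_hermitian(2,3)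
    have "mtrace (A k * ?Y j) = mtrace ((A k * H k j * W j) * ((W j)\<^sup>H * (H k j)\<^sup>H))"
      by (simp add: mat_mult_assoc_dim d)
    also have "\<dots> = mtrace (((W j)\<^sup>H * (H k j)\<^sup>H) * (A k * H k j * W j))"
      by (rule mtrace_comm) (simp_all add: d)
    finally show ?thesis by (simp add: mat_mult_assoc_dim d)
  qed
  have "mtrace (A k * (F W k + ?Y k))
      = mtrace (A k * ?M) + complex_of_real ((\<sigma> k)\<^sup>2) * mtrace (A k) + mtrace (A k * ?Y k)"
    unfolding F_mat_def using Y[OF k] A_hermitian(2,3) W_dims[OF W k]
    by (simp add: mat_mult_add_dim mat_mult_smult_dim mtrace_simps dims del: of_real_power)
  also have "mtrace (A k * ?M) = (\<Sum>j\<in>{1..K} - {k}. mtrace (A k * ?Y j))"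
    using A_hermitian(2,3) by (intro mtrace_mult_msum Y) auto
  also have "\<dots> + complex_of_real ((\<sigma> k)\<^sup>2) * mtrace (A k) + mtrace (A k * ?Y k)
      = complex_of_real ((\<sigma> k)\<^sup>2) * mtrace (A k) + (\<Sum>j = 1..K. mtrace (A k * ?Y j))"
    using k by (subst sum.remove[of "{1..K}" k "\<lambda>j. mtrace (A k * ?Y j)"]) auto
  also have "(\<Sum>j = 1..K. mtrace (A k * ?Y j))
      = (\<Sum>j = 1..K. mtrace ((W j)\<^sup>H * ((H k j)\<^sup>H * A k * H k j * W j)))"
    by (intro sum.cong refl summand)
  finally show ?thesis unfolding Yk .
qed

text \<open>The bound of \<open>rate_lower_bound\<close> for link \<open>k\<close>, with the total
  covariance split by transmitter. It is quadratic in all beamformers, not only in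
  \<open>W k\<close>, which is why the quadratic parts must be regrouped after summation.\<close>

definition minorant where
  "minorant W = R V k - Re (mtrace ((V k)\<^sup>H * (H k k)\<^sup>H * minv (F V k) * H k k * V k))
     - (\<sigma> k)\<^sup>2 * Re (mtrace (A k)) + 2 * Re (mtrace (B k * H k k * W k))
     - (\<Sum>j = 1..K. Re (mtrace ((W j)\<^sup>H * ((H k j)\<^sup>H * A k * H k j * W j))))"

lemma minorant_eq:
  assumes W: "W \<in> X"
  shows "minorant W = R V k - Re (mtrace (G\<^sup>H * (minv (F V k) * G)))
    + 2 * Re (mtrace (B k * (H k k * W k)))
    - Re (mtrace (A k * (F W k + (H k k * W k) * (H k k * W k)\<^sup>H)))"
proof -
  have "(V k)\<^sup>H * (H k k)\<^sup>H * minv (F V k) * H k k * V k = G\<^sup>H * (minv (F V k) * G)"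
    unfolding G_def by (simp add: mat_ring_simps dims)
  moreover have "B k * H k k * W k = B k * (H k k * W k)"
    using B_carrier W_dims[OF W k] by (simp add: mat_mult_assoc_dim dims)
  moreover have "Re (mtrace (A k * (F W k + (H k k * W k) * (H k k * W k)\<^sup>H))) = (\<sigma> k)\<^sup>2 * Re (mtrace (A k))
     + (\<Sum>j = 1..K. Re (mtrace ((W j)\<^sup>H * ((H k j)\<^sup>H * A k * H k j * W j))))"
    unfolding mtrace_A_total[OF W] by (simp del: of_real_power)
  ultimately show ?thesis unfolding minorant_def by simp
qed

lemma minorant_le:
  assumes W: "W \<in> X"
  shows "minorant W \<le> R W k"
proof -
  have "H k k * W k \<in> carrier_mat (Mr k) (Ms k)" using H[OF k k] X_D[OF W k] by auto
  from rate_lower_bound(1)[OF F_pos_def[OF W k] this F_pos_def[OF V k] G]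
  show ?thesis
    unfolding minorant_eq[OF W] rate_eq[OF W k] rate_eq[OF V k] B_eq A_eq G_def[symmetric] .
qed

text \<open>At the base point the three traces coincide and enter with coefficients
  \<open>- 1\<close>, \<open>2\<close> and \<open>- 1\<close>.\<close>

lemma minorant_V: "minorant V = R V k"
proof -
  have "mtrace (A k * (F V k + G * G\<^sup>H)) = mtrace (B k * G)"
    using rate_lower_bound(5)[OF F_pos_def[OF V k] G F_pos_def[OF V k] G]
    unfolding A_eq B_eq .
  moreover have "B k * G = G\<^sup>H * (minv (F V k) * G)"
    unfolding B_eq using carrier_matD[OF G] by (simp add: mat_mult_assoc_dim dims)
  ultimately show ?thesis unfolding minorant_eq[OF V] G_def[symmetric] by simp
qed

end

section \<open>Regrouping by transmitter and the surrogate inequality\<close>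

lemma S_carrier: "S k \<in> carrier_mat (Mt k) (Mt k)"
  by (auto simp: S_mat_def)

lemma S_summand_carrier:
  assumes "k \<in> {1..K}" "j \<in> {1..K}"
  shows "complex_of_real (\<omega> j) \<cdot>\<^sub>m ((H j k)\<^sup>H * A j * H j k) \<in> carrier_mat (Mt k) (Mt k)"
  using H[OF assms(2,1)] A_hermitian(2,3)[OF assms(2)] by auto

lemma S_hermitian:
  assumes k: "k \<in> {1..K}"
  shows "(S k)\<^sup>H = S k"
proof -
  have "(S k)\<^sup>H = msum (Mt k) (Mt k)
      (\<lambda>j. (complex_of_real (\<omega> j) \<cdot>\<^sub>m ((H j k)\<^sup>H * A j * H j k))\<^sup>H) {1..K}"
    unfolding S_mat_def by (intro msum_adjoint S_summand_carrier k)
  also have "\<dots> = S k"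
    unfolding S_mat_def msum_def
  proof (intro cong_mat refl, clarify, intro sum.cong refl)
    fix a b j assume j: "j \<in> {1..K}"
    have "(complex_of_real (\<omega> j) \<cdot>\<^sub>m ((H j k)\<^sup>H * A j * H j k))\<^sup>H
        = complex_of_real (\<omega> j) \<cdot>\<^sub>m ((H j k)\<^sup>H * A j * H j k)"
      using H_dims[OF j k] A_hermitian[OF j] by (simp add: mat_ring_simps)
    thus "(complex_of_real (\<omega> j) \<cdot>\<^sub>m ((H j k)\<^sup>H * A j * H j k))\<^sup>H $$ (a, b)
        = (complex_of_real (\<omega> j) \<cdot>\<^sub>m ((H j k)\<^sup>H * A j * H j k)) $$ (a, b)" by (simp only:)
  qed
  finally show ?thesis .
qed

lemma D_pos_semidef:
  assumes "k \<in> {1..K}"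
  shows "pos_semidef (Mt k) (D k)"
  using S_carrier S_hermitian[OF assms] \<eta>_ge[OF assms] by (rule lambda_max_pos_semidef)

text \<open>Interchanging the sums collects at transmitter \<open>j\<close> the quadratic terms that
  the bounds of all receivers \<open>k\<close> place on \<open>W j\<close>. This explains the order
  of the indices of \<open>H\<close> in \<open>S_mat\<close>.\<close>

lemma sum_forms:
  assumes W: "W \<in> X"
  shows "(\<Sum>k = 1..K. \<omega> k * (\<Sum>j = 1..K. Re (mtrace ((W j)\<^sup>H * ((H k j)\<^sup>H * A k * H k j * W j)))))
    = (\<Sum>j = 1..K. Re (mtrace ((W j)\<^sup>H * (S j * W j))))"
proof -
  have "Re (mtrace ((W j)\<^sup>H * (S j * W j)))
      = (\<Sum>k = 1..K. \<omega> k * Re (mtrace ((W j)\<^sup>H * ((H k j)\<^sup>H * A k * H k j * W j))))"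
    if j: "j \<in> {1..K}" for j
  proof -
    have "Re (mtrace ((W j)\<^sup>H * (S j * W j))) = Re (\<Sum>k = 1..K. mtrace ((W j)\<^sup>H
        * (complex_of_real (\<omega> k) \<cdot>\<^sub>m ((H k j)\<^sup>H * A k * H k j) * W j)))"
      unfolding S_mat_def using W_dims[OF W j] by (intro arg_cong[where f = Re] mtrace_form_msum S_summand_carrier j)
    also have "\<dots> = (\<Sum>k = 1..K. \<omega> k * Re (mtrace ((W j)\<^sup>H * ((H k j)\<^sup>H * A k * H k j * W j))))"
      unfolding Re_sum
    proof (intro sum.cong refl)
      fix k assume k: "k \<in> {1..K}"
      show "Re (mtrace ((W j)\<^sup>H * (complex_of_real (\<omega> k) \<cdot>\<^sub>m ((H k j)\<^sup>H * A k * H k j) * W j)))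
          = \<omega> k * Re (mtrace ((W j)\<^sup>H * ((H k j)\<^sup>H * A k * H k j * W j)))"
        using W_dims[OF W j] H_dims[OF k j] A_hermitian(2,3)[OF k]
        by (simp add: mat_smult_mult_dim mat_mult_smult_dim mtrace_smult)
    qed
    finally show ?thesis .
  qed
  hence "(\<Sum>j = 1..K. Re (mtrace ((W j)\<^sup>H * (S j * W j))))
      = (\<Sum>j = 1..K. \<Sum>k = 1..K. \<omega> k * Re (mtrace ((W j)\<^sup>H * ((H k j)\<^sup>H * A k * H k j * W j))))"
    by (intro sum.cong refl)
  thus ?thesis by (simp only: sum_distrib_left) (rule sum.swap)
qed

lemma surrogate_eq:
  assumes W: "W \<in> X"
  shows "l W = (\<Sum>k = 1..K. \<omega> k * minorant k W)
    - (\<Sum>k = 1..K. Re (mtrace ((W k - V k)\<^sup>H * (D k * (W k - V k)))))"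
proof -
  have "l W = - (\<Sum>k = 1..K. Re (mtrace ((W k)\<^sup>H * (S k * W k)))
        + Re (mtrace ((W k - V k)\<^sup>H * (D k * (W k - V k)))))
     + (\<Sum>k = 1..K. 2 * \<omega> k * Re (mtrace (B k * H k k * W k)))
     + (\<Sum>k = 1..K. \<omega> k * (R V k
            - Re (mtrace ((V k)\<^sup>H * (H k k)\<^sup>H * minv (F V k) * H k k * V k))
            - (\<sigma> k)\<^sup>2 * Re (mtrace (A k))))"
    unfolding ell'_def
    using majorizer_eq[OF X_D(1)[OF W] X_D(1)[OF V] S_carrier S_hermitian]
    by (intro arg_cong2[where f = "(+)"] arg_cong[where f = uminus] sum.cong refl) auto
  moreover have "(\<Sum>k = 1..K. \<omega> k * minorant k W)
      = (\<Sum>k = 1..K. \<omega> k * (R V k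
            - Re (mtrace ((V k)\<^sup>H * (H k k)\<^sup>H * minv (F V k) * H k k * V k))
            - (\<sigma> k)\<^sup>2 * Re (mtrace (A k))))
        + (\<Sum>k = 1..K. 2 * \<omega> k * Re (mtrace (B k * H k k * W k)))
        - (\<Sum>k = 1..K. Re (mtrace ((W k)\<^sup>H * (S k * W k))))"
    unfolding sum_forms[OF W, symmetric] sum.distrib[symmetric] sum_subtractf[symmetric]
    by (intro sum.cong refl) (simp add: minorant_def algebra_simps)
  ultimately show ?thesis by (simp add: sum.distrib)
qed

lemma surrogate_le:
  assumes W: "W \<in> X"
  shows "l W \<le> f W"
proof -
  have "0 \<le> (\<Sum>k = 1..K. Re (mtrace ((W k - V k)\<^sup>H * (D k * (W k - V k)))))"
  proof (rule sum_nonneg)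
    fix k assume k: "k \<in> {1..K}"
    show "0 \<le> Re (mtrace ((W k - V k)\<^sup>H * (D k * (W k - V k))))"
      using W_dims[OF V k] by (intro pos_semidefD(5)[OF D_pos_semidef[OF k]]) simp
  qed
  moreover have "(\<Sum>k = 1..K. \<omega> k * minorant k W) \<le> f W"
    unfolding sum_rate_def by (intro sum_mono mult_left_mono minorant_le W) (auto intro!: less_imp_le[OF \<omega>])
  ultimately show ?thesis unfolding surrogate_eq[OF W] by linarith
qed

lemma surrogate_V: "l V = f V"
proof -
  have "Re (mtrace ((V k - V k)\<^sup>H * (D k * (V k - V k)))) = 0" if k: "k \<in> {1..K}" for k
  proof -
    have "V k - V k = 0\<^sub>m (Mt k) (Ms k)" using X_D(1)[OF V k] by auto
    moreover have "(0\<^sub>m (Mt k) (Ms k))\<^sup>H * (D k * 0\<^sub>m (Mt k) (Ms k)) = 0\<^sub>m (Ms k) (Ms k)"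
      using S_carrier[of k] by (intro eq_matI) auto
    ultimately show ?thesis by simp
  qed
  thus ?thesis unfolding surrogate_eq[OF V] sum_rate_def by (simp add: minorant_V)
qed

section \<open>The maximisers of the surrogate\<close>

definition dist_Q where "dist_Q W = (\<Sum>k = 1..K. \<eta> k * (frob_norm (W k - Q k))\<^sup>2)"

text \<open>The argument starts from \<open>ell'\<close> itself, where the quadratic part is already
  scalar, and not from the minorants. The constant stays hidden, as only its independence of
  \<open>W\<close> matters.\<close>

lemma surrogate_complete_square:
  obtains C where "\<And>W. W \<in> X \<Longrightarrow> l W = C - dist_Q W"
proof
  fix W assume W: "W \<in> X"
  have "Re (mtrace (complex_of_real (\<eta> k) \<cdot>\<^sub>m ((W k)\<^sup>H * W k)
           + two_Re ((W k)\<^sup>H * (S k - complex_of_real (\<eta> k) \<cdot>\<^sub>m 1\<^sub>m (Mt k)) * V k)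
           + (V k)\<^sup>H * D k * V k))
      = \<eta> k * (frob_norm (W k - Q k))\<^sup>2 - \<eta> k * (frob_norm (Q k))\<^sup>2
        + 2 * \<omega> k * Re (mtrace (B k * H k k * W k)) + Re (mtrace ((V k)\<^sup>H * D k * V k))"
    if k: "k \<in> {1..K}" for k
  proof -
    let ?R = "S k - complex_of_real (\<eta> k) \<cdot>\<^sub>m 1\<^sub>m (Mt k)"
    have "dim_row ?R = Mt k" "dim_col ?R = Mt k" "dim_row (D k) = Mt k" "dim_col (D k) = Mt k"
      using S_carrier[of k] by auto
    note d = this W_dims[OF W k] W_dims[OF V k]
    have "Re (mtrace (complex_of_real (\<eta> k) \<cdot>\<^sub>m ((W k)\<^sup>H * W k)
           + two_Re ((W k)\<^sup>H * ?R * V k) + (V k)\<^sup>H * D k * V k))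
        = \<eta> k * (frob_norm (W k))\<^sup>2 + 2 * Re (mtrace ((W k)\<^sup>H * (?R * V k)))
          + Re (mtrace ((V k)\<^sup>H * D k * V k))"
      using d by (simp add: two_Re_def frob_norm_sq mtrace_simps mtrace_adjoint mat_mult_assoc_dim)
    with complete_square[OF X_D(1)[OF W k] X_D(1)[OF V k] S_carrier B_carrier[OF k] H[OF k k] \<eta>[OF k],
        of "\<omega> k", folded Q_mat_def]
    show ?thesis by simp
  qed
  hence "(\<Sum>k = 1..K. Re (mtrace (complex_of_real (\<eta> k) \<cdot>\<^sub>m ((W k)\<^sup>H * W k)
           + two_Re ((W k)\<^sup>H * (S k - complex_of_real (\<eta> k) \<cdot>\<^sub>m 1\<^sub>m (Mt k)) * V k)
           + (V k)\<^sup>H * D k * V k)))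
      = (\<Sum>k = 1..K. \<eta> k * (frob_norm (W k - Q k))\<^sup>2 - \<eta> k * (frob_norm (Q k))\<^sup>2
        + 2 * \<omega> k * Re (mtrace (B k * H k k * W k)) + Re (mtrace ((V k)\<^sup>H * D k * V k)))"
    by (intro sum.cong refl)
  thus "l W = (\<Sum>k = 1..K. \<eta> k * (frob_norm (Q k))\<^sup>2 - Re (mtrace ((V k)\<^sup>H * D k * V k))
      + \<omega> k * (R V k - Re (mtrace ((V k)\<^sup>H * (H k k)\<^sup>H * minv (F V k) * H k k * V k))
      - (\<sigma> k)\<^sup>2 * Re (mtrace (A k)))) - dist_Q W"
    unfolding ell'_def dist_Q_def by (simp add: sum.distrib sum_subtractf)
qed

lemma arg_max_iff_arg_min:
  "is_arg_max l (\<lambda>W. W \<in> X) W \<longleftrightarrow> is_arg_min dist_Q (\<lambda>W. W \<in> X) W"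
proof -
  obtain C where "\<And>W. W \<in> X \<Longrightarrow> l W = C - dist_Q W" by (rule surrogate_complete_square) blast
  thus ?thesis unfolding is_arg_max_def is_arg_min_def by auto
qed

definition proj where
  "proj k = complex_of_real (min (sqrt (P k / (frob_norm (Q k))\<^sup>2)) 1) \<cdot>\<^sub>m Q k"

lemma Q_carrier:
  assumes k: "k \<in> {1..K}"
  shows "Q k \<in> carrier_mat (Mt k) (Ms k)"
  unfolding Q_mat_def using H_dims[OF k k] B_carrier[OF k] S_carrier[of k] X_D(1)[OF V k] by auto

lemma proj_feasible:
  assumes k: "k \<in> {1..K}"
  shows "proj k \<in> carrier_mat (Mt k) (Ms k)" "(frob_norm (proj k))\<^sup>2 \<le> P k"
  unfolding proj_def using Q_carrier[OF k] ball_projection(1)[OF P[OF k]] by auto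

lemma proj_closest:
  assumes W: "W \<in> X" and k: "k \<in> {1..K}" and neq: "W k \<noteq> proj k"
  shows "\<eta> k * (frob_norm (proj k - Q k))\<^sup>2 < \<eta> k * (frob_norm (W k - Q k))\<^sup>2"
  using W_dims[OF W k] X_D(2)[OF W k] Q_carrier[OF k] neq \<eta>[OF k] unfolding proj_def
  by (intro mult_strict_left_mono ball_projection(2) P k) auto

text \<open>The objective is a sum over links and the constraints are imposed link by link, so the
  problem decouples. Strictness in \<open>proj_closest\<close> gives uniqueness on the
  links.\<close>

lemma arg_min_iff_proj:
  "is_arg_min dist_Q (\<lambda>W. W \<in> X) W \<longleftrightarrow> (\<forall>k\<in>{1..K}. W k = proj k)"
proof
  assume min: "is_arg_min dist_Q (\<lambda>W. W \<in> X) W"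
  hence W: "W \<in> X" by (simp add: is_arg_min_def)
  show "\<forall>k\<in>{1..K}. W k = proj k"
  proof (rule ccontr)
    assume "\<not> ?thesis"
    then obtain k where k: "k \<in> {1..K}" "W k \<noteq> proj k" by blast
    \<comment> \<open>Correcting a single link preserves feasibility and strictly lowers one summand
      while leaving the others unchanged.\<close>
    define Y where "Y = W(k := proj k)"
    have "Y \<in> X" using W proj_feasible[OF k(1)] by (auto simp: Y_def feasible_def)
    moreover have "dist_Q Y < dist_Q W"
      unfolding dist_Q_def
    proof (rule sum_strict_mono_ex1)
      show "\<forall>j\<in>{1..K}. \<eta> j * (frob_norm (Y j - Q j))\<^sup>2 \<le> \<eta> j * (frob_norm (W j - Q j))\<^sup>2"
        using proj_closest[OF W k] by (auto simp: Y_def)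
      show "\<exists>j\<in>{1..K}. \<eta> j * (frob_norm (Y j - Q j))\<^sup>2 < \<eta> j * (frob_norm (W j - Q j))\<^sup>2"
        using proj_closest[OF W k] k(1) by (intro bexI[of _ k]) (auto simp: Y_def)
    qed simp
    ultimately show False using min by (auto simp: is_arg_min_def)
  qed
next
  assume eq: "\<forall>k\<in>{1..K}. W k = proj k"
  have "W \<in> X" using eq proj_feasible by (auto simp: feasible_def)
  moreover have "dist_Q W \<le> dist_Q Y" if "Y \<in> X" for Y
    unfolding dist_Q_def
  proof (rule sum_mono)
    fix k assume k: "k \<in> {1..K}"
    with eq have "W k = proj k" by blast
    thus "\<eta> k * (frob_norm (W k - Q k))\<^sup>2 \<le> \<eta> k * (frob_norm (Y k - Q k))\<^sup>2"
      using proj_closest[OF that k] by (cases "Y k = proj k") auto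
  qed
  ultimately show "is_arg_min dist_Q (\<lambda>W. W \<in> X) W"
    by (auto simp: is_arg_min_def not_less)
qed

end

text \<open>Equivalence of the two problems is expressed as equality of their solution sets. The
  last conjunct contains both existence and uniqueness of the maximiser on the links; for
  \<open>Q k = 0\<close> the scaled matrix is zero whatever the factor.\<close>

theorem mainTheorem7:
  fixes K :: nat
    and Mr Mt Ms :: "nat \<Rightarrow> nat"
    and H :: "nat \<Rightarrow> nat \<Rightarrow> complex mat"
    and \<sigma> \<omega> P \<eta> :: "nat \<Rightarrow> real"
    and V :: "nat \<Rightarrow> complex mat"
  defines "X \<equiv> feasible K Mt Ms P"
    and "f \<equiv> sum_rate K Mr Ms H \<sigma> \<omega>"
    and "l \<equiv> (\<lambda>W. ell' K Mr Mt Ms H \<sigma> \<omega> \<eta> W V)"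
    and "S \<equiv> S_mat K Mr Mt H \<sigma> \<omega> V"
    and "Q \<equiv> Q_mat K Mr Mt H \<sigma> \<omega> \<eta> V"
  assumes "\<And>i j. i \<in> {1..K} \<Longrightarrow> j \<in> {1..K} \<Longrightarrow> H i j \<in> carrier_mat (Mr i) (Mt j)"
    and "\<And>k. k \<in> {1..K} \<Longrightarrow> (\<sigma> k)\<^sup>2 > 0"
    and "\<And>k. k \<in> {1..K} \<Longrightarrow> \<omega> k > 0"
    and "\<And>k. k \<in> {1..K} \<Longrightarrow> P k > 0"
    and "V \<in> X"
    and "\<And>k. k \<in> {1..K} \<Longrightarrow> \<eta> k > 0"
    and "\<And>k. k \<in> {1..K} \<Longrightarrow> \<eta> k \<ge> lambda_max (S k)"
  shows "(\<forall>W\<in>X. l W \<le> f W) \<and> l V = f V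
    \<and> (\<forall>W. is_arg_max l (\<lambda>W. W \<in> X) W \<longleftrightarrow>
           is_arg_min (\<lambda>W. \<Sum>k = 1..K. \<eta> k * (frob_norm (W k - Q k))\<^sup>2) (\<lambda>W. W \<in> X) W)
    \<and> (\<forall>W. is_arg_max l (\<lambda>W. W \<in> X) W \<longleftrightarrow>
           (\<forall>k\<in>{1..K}. W k =
              complex_of_real (min (sqrt (P k / (frob_norm (Q k))\<^sup>2)) 1) \<cdot>\<^sub>m Q k))"
proof -
  interpret wsr: weighted_sum_rate K Mr Mt Ms H \<sigma> \<omega> P \<eta> V
    using assms(6-12) unfolding X_def S_def by unfold_locales blast+
  have dist_Q: "wsr.dist_Q = (\<lambda>W. \<Sum>k = 1..K. \<eta> k * (frob_norm (W k - Q k))\<^sup>2)"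
    by (simp add: fun_eq_iff wsr.dist_Q_def Q_def)
  show ?thesis
    unfolding X_def f_def l_def dist_Q[symmetric]
    using wsr.surrogate_le wsr.surrogate_V wsr.arg_max_iff_arg_min wsr.arg_min_iff_proj
    unfolding wsr.proj_def Q_def by blast
qed

end
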